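(* Let $F$ be a field of characteristic zero, $\mathcal{A}$ a KV-algebra over $F$, and $W$ a KV-module for $\mathcal{A}$, regarded as a trivial KV-algebra (i.e. with zero multiplication). Then there is a one-to-one map from $H^2(\mathcal{A},W)$ onto the set of equivalence classes of splittable extensions of $\mathcal{A}$ by $W$.
   Context: A KV-algebra over $F$ is an $F$-vector space $\mathcal{A}$ with a bilinear multiplication such that the associator $(a,b,c)=(ab)c-a(bc)$ satisfies $(a,b,c)=(b,a,c)$ for all $a,b,c$. An $\mathcal{A}$-KV-module is an $F$-vector space $W$ with bilinear maps $(a,w)\mapsto aw$, $(w,a)\mapsto wa$ into $W$ such that $(a,b,w)=(b,a,w)$ and $(a,w,b)=(w,a,b)$ for all $a,b\in\mathcal{A}$, $w\in W$, where $(a,b,w)=(ab)w-a(bw)$, $(a,w,b)=(aw)b-a(wb)$, $(w,a,b)=(wa)b-w(ab)$. For $q\ge1$, $C_q(\mathcal{A},W)$ is the space of $q$-linear maps from $\mathcal{A}$ to $W$, and $\delta:C_q(\mathcal{A},W)\to C_{q+1}(\mathcal{A},W)$ is $$(\delta f)(a_1,\dots,a_{q+1})=\sum_{j=1}^{q}(-1)^j\Big\{(a_jf)(a_1,\dots,\widehat{a_j},\dots,a_{q+1})+\big(f(a_1,\dots,\widehat{a_j},\dots,a_q,a_j)\big)a_{q+1}\Big\},$$ with $(af)(b_1,\dots,b_q)=a(f(b_1,\dots,b_q))-\sum_i f(b_1,\dots,ab_i,\dots,b_q)$. One has $\delta\circ\delta=0$, and $H^2(\mathcal{A},W)=\ker(\delta|_{C_2(\mathcal{A},W)})/\delta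 C_1(\mathcal{A},W)$. An extension of $\mathcal{A}$ by $W$ is an exact sequence of KV-algebras $0\to W\to T\stackrel{\mu}{\to}\mathcal{A}\to0$ in which $W$ is a two-sided ideal of $T$ with zero multiplication and the induced actions are the given ones: $t\cdot w=\mu(t)w$ and $w\cdot t=w\mu(t)$ for $t\in T$, $w\in W$. It is splittable if the subspace $W$ is a direct summand of the vector space $T$ (equivalently, there is a linear section $\mathcal{A}\to T$). Two extensions are equivalent if there is an isomorphism of KV-algebras between the middle terms inducing the identity on $W$ and on $\mathcal{A}$. *)

theory Defs
  imports "HOL-Algebra.AbelCoset" "HOL-Algebra.Module"
begin

definition linear_map ::
  "('f, 'm) ring_scheme \<Rightarrow> ('f, 'v, 'n) module_scheme \<Rightarrow> ('f, 'w, 'k) module_scheme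
    \<Rightarrow> ('v \<Rightarrow> 'w) \<Rightarrow> bool"
  where "linear_map F V W f \<longleftrightarrow>
    f \<in> carrier V \<rightarrow> carrier W \<and>
    (\<forall>x\<in>carrier V. \<forall>y\<in>carrier V. f (x \<oplus>\<^bsub>V\<^esub> y) = f x \<oplus>\<^bsub>W\<^esub> f y) \<and>
    (\<forall>c\<in>carrier F. \<forall>x\<in>carrier V. f (c \<odot>\<^bsub>V\<^esub> x) = c \<odot>\<^bsub>W\<^esub> f x)"

definition bilinear_map ::
  "('f, 'm) ring_scheme \<Rightarrow> ('f, 'u, 'l) module_scheme \<Rightarrow> ('f, 'v, 'n) module_scheme
    \<Rightarrow> ('f, 'w, 'k) module_scheme \<Rightarrow> ('u \<Rightarrow> 'v \<Rightarrow> 'w) \<Rightarrow> bool"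
  where "bilinear_map F U V W b \<longleftrightarrow>
    (\<forall>u\<in>carrier U. linear_map F V W (\<lambda>v. b u v)) \<and>
    (\<forall>v\<in>carrier V. linear_map F U W (\<lambda>u. b u v))"

text \<open>
  The record type \<open>('f, 'a) module\<close> extends \<open>'a ring\<close>. A KV-algebra uses its field \<open>mult\<close> for the
  (in general neither associative nor unital) product; its field \<open>one\<close> plays no role.
\<close>

locale kv_algebra = K?: field F + V?: module F A
  for F :: "('f, 'm) ring_scheme" (structure) and A :: "('f, 'a, 'n) module_scheme" (structure) +
  assumes mult_bilinear: "bilinear_map F A A A (mult A)"
    and associator_sym: "\<And>a b c. \<lbrakk>a \<in> carrier A; b \<in> carrier A; c \<in> carrier A\<rbrakk> \<Longrightarrow>
      (a \<otimes>\<^bsub>A\<^esub> b) \<otimes>\<^bsub>A\<^esub> c \<ominus>\<^bsub>A\<^esub> a \<otimes>\<^bsub>A\<^esub> (b \<otimes>\<^bsub>A\<^esub> c) =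
      (b \<otimes>\<^bsub>A\<^esub> a) \<otimes>\<^bsub>A\<^esub> c \<ominus>\<^bsub>A\<^esub> b \<otimes>\<^bsub>A\<^esub> (a \<otimes>\<^bsub>A\<^esub> c)"

text \<open>
  \<open>lact W a w\<close> is $aw$ and \<open>ract W w a\<close> is $wa$. The fields \<open>mult\<close> and \<open>one\<close> of \<open>W\<close> play no role.
\<close>

record ('f, 'a, 'w) kvmod = "('f, 'w) module" +
  lact :: "'a \<Rightarrow> 'w \<Rightarrow> 'w"
  ract :: "'w \<Rightarrow> 'a \<Rightarrow> 'w"

locale kv_module = alg: kv_algebra F A + W: module F W
  for F :: "('f, 'm) ring_scheme" and A :: "('f, 'a, 'n) module_scheme"
    and W :: "('f, 'a, 'w, 'k) kvmod_scheme" +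
  assumes lact_bilinear: "bilinear_map F A W W (lact W)"
    and ract_bilinear: "bilinear_map F W A W (ract W)"
    and left_associator_sym:
      "\<And>a b w. \<lbrakk>a \<in> carrier A; b \<in> carrier A; w \<in> carrier W\<rbrakk> \<Longrightarrow>
        lact W (a \<otimes>\<^bsub>A\<^esub> b) w \<ominus>\<^bsub>W\<^esub> lact W a (lact W b w) =
        lact W (b \<otimes>\<^bsub>A\<^esub> a) w \<ominus>\<^bsub>W\<^esub> lact W b (lact W a w)"
    and mixed_associator_sym:
      "\<And>a b w. \<lbrakk>a \<in> carrier A; b \<in> carrier A; w \<in> carrier W\<rbrakk> \<Longrightarrow>
        ract W (lact W a w) b \<ominus>\<^bsub>W\<^esub> lact W a (ract W w b) =
        ract W (ract W w a) b \<ominus>\<^bsub>W\<^esub> ract W w (a \<otimes>\<^bsub>A\<^esub> b)"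

text \<open>
  A $q$-cochain is a function on the lists of length $q$ over \<open>carrier A\<close>, with the value
  \<open>undefined\<close> elsewhere so that HOL equality of cochains is equality of maps.
\<close>

definition tuples :: "('f, 'a, 'n) module_scheme \<Rightarrow> nat \<Rightarrow> 'a list set"
  where "tuples A q = {as. length as = q \<and> set as \<subseteq> carrier A}"

definition multilinear_maps ::
  "('f, 'm) ring_scheme \<Rightarrow> ('f, 'a, 'n) module_scheme \<Rightarrow> ('f, 'w, 'k) module_scheme
    \<Rightarrow> nat \<Rightarrow> ('a list \<Rightarrow> 'w) set"
  where "multilinear_maps F A W q =
    {f \<in> tuples A q \<rightarrow>\<^sub>E carrier W. \<forall>as\<in>tuples A q. \<forall>i<q. linear_map F A W (\<lambda>x. f (as[i := x]))}"

definition cochain_group ::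
  "('f, 'm) ring_scheme \<Rightarrow> ('f, 'a, 'n) module_scheme \<Rightarrow> ('f, 'a, 'w, 'k) kvmod_scheme
    \<Rightarrow> nat \<Rightarrow> ('a list \<Rightarrow> 'w) monoid"
  where "cochain_group F A W q =
    \<lparr>carrier = multilinear_maps F A W q,
     mult = (\<lambda>f g. \<lambda>as\<in>tuples A q. f as \<oplus>\<^bsub>W\<^esub> g as),
     one = (\<lambda>as\<in>tuples A q. \<zero>\<^bsub>W\<^esub>)\<rparr>"

definition cochain_act ::
  "('f, 'a, 'n) module_scheme \<Rightarrow> ('f, 'a, 'w, 'k) kvmod_scheme
    \<Rightarrow> 'a \<Rightarrow> ('a list \<Rightarrow> 'w) \<Rightarrow> 'a list \<Rightarrow> 'w"
  where "cochain_act A W a f bs =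
    lact W a (f bs) \<ominus>\<^bsub>W\<^esub> (\<Oplus>\<^bsub>W\<^esub>i\<in>{..<length bs}. f (bs[i := a \<otimes>\<^bsub>A\<^esub> bs ! i]))"

text \<open>The position \<open>j\<close> is counted from 1, as in $(a_1, \dots, a_{q+1})$.\<close>

definition omit :: "nat \<Rightarrow> 'a list \<Rightarrow> 'a list"
  where "omit j as = take (j - 1) as @ drop j as"

definition coboundary ::
  "('f, 'm) ring_scheme \<Rightarrow> ('f, 'a, 'n) module_scheme \<Rightarrow> ('f, 'a, 'w, 'k) kvmod_scheme
    \<Rightarrow> nat \<Rightarrow> ('a list \<Rightarrow> 'w) \<Rightarrow> ('a list \<Rightarrow> 'w)"
  where "coboundary F A W q f =
    (\<lambda>as\<in>tuples A (q + 1). \<Oplus>\<^bsub>W\<^esub>j\<in>{1..q}. ((\<ominus>\<^bsub>F\<^esub> \<one>\<^bsub>F\<^esub>) [^]\<^bsub>F\<^esub> j) \<odot>\<^bsub>W\<^esub>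
      (cochain_act A W (as ! (j - 1)) f (omit j as) \<oplus>\<^bsub>W\<^esub>
       ract W (f (omit j (butlast as) @ [as ! (j - 1)])) (last as)))"

definition kv_H2 ::
  "('f, 'm) ring_scheme \<Rightarrow> ('f, 'a, 'n) module_scheme \<Rightarrow> ('f, 'a, 'w, 'k) kvmod_scheme
    \<Rightarrow> ('a list \<Rightarrow> 'w) set monoid"
  where "kv_H2 F A W =
    (cochain_group F A W 2)
      \<lparr>carrier := kernel (cochain_group F A W 2) (cochain_group F A W 3) (coboundary F A W 2)\<rparr>
    Mod (coboundary F A W 1 ` carrier (cochain_group F A W 1))"

definition kv_hom ::
  "('f, 'm) ring_scheme \<Rightarrow> ('f, 'a, 'n) module_scheme \<Rightarrow> ('f, 'b, 'k) module_scheme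
    \<Rightarrow> ('a \<Rightarrow> 'b) set"
  where "kv_hom F A B = {h. linear_map F A B h \<and>
    (\<forall>x\<in>carrier A. \<forall>y\<in>carrier A. h (x \<otimes>\<^bsub>A\<^esub> y) = h x \<otimes>\<^bsub>B\<^esub> h y)}"

definition trivial_kv :: "('f, 'w, 'k) module_scheme \<Rightarrow> ('f, 'w, 'k) module_scheme"
  where "trivial_kv W = W\<lparr>mult := \<lambda>_ _. \<zero>\<^bsub>W\<^esub>\<rparr>"

text \<open>
  An extension is a triple \<open>(T, \<iota>, \<mu>)\<close>, with $W$ identified with its image in $T$ under the
  injection \<open>\<iota>\<close>. That this image is a two-sided ideal with zero multiplication is
  part of exactness and of \<open>\<iota>\<close> being a homomorphism from the trivial algebra.
  The middle terms range over all KV-algebras on subsets of the type \<open>'t\<close>; since the middle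
  term of a splittable extension is in bijection with \<open>carrier A \<times> carrier W\<close>, every type into which
  that set embeds accommodates all of them up to equivalence.
\<close>

type_synonym ('f, 'a, 'w, 't) ext_data = "('f, 't) module \<times> ('w \<Rightarrow> 't) \<times> ('t \<Rightarrow> 'a)"

definition extension ::
  "('f, 'm) ring_scheme \<Rightarrow> ('f, 'a, 'n) module_scheme \<Rightarrow> ('f, 'a, 'w, 'k) kvmod_scheme
    \<Rightarrow> ('f, 'a, 'w, 't) ext_data \<Rightarrow> bool"
  where "extension F A W = (\<lambda>(T, \<iota>, \<mu>).
    kv_algebra F T \<and> \<iota> \<in> kv_hom F (trivial_kv W) T \<and> \<mu> \<in> kv_hom F T A \<and>
    inj_on \<iota> (carrier W) \<and> \<iota> ` carrier W = a_kernel T A \<mu> \<and> \<mu> ` carrier T = carrier A \<and>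
    (\<forall>t\<in>carrier T. \<forall>w\<in>carrier W.
      t \<otimes>\<^bsub>T\<^esub> \<iota> w = \<iota> (lact W (\<mu> t) w) \<and> \<iota> w \<otimes>\<^bsub>T\<^esub> t = \<iota> (ract W w (\<mu> t))))"

definition splittable ::
  "('f, 'm) ring_scheme \<Rightarrow> ('f, 'a, 'w, 'k) kvmod_scheme \<Rightarrow> ('f, 'a, 'w, 't) ext_data \<Rightarrow> bool"
  where "splittable F W = (\<lambda>(T, \<iota>, \<mu>).
    \<exists>S. submodule S F T \<and> \<iota> ` carrier W \<inter> S = {\<zero>\<^bsub>T\<^esub>} \<and>
      \<iota> ` carrier W <+>\<^bsub>T\<^esub> S = carrier T)"

definition ext_equiv ::
  "('f, 'm) ring_scheme \<Rightarrow> ('f, 'a, 'w, 'k) kvmod_scheme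
    \<Rightarrow> ('f, 'a, 'w, 't) ext_data \<Rightarrow> ('f, 'a, 'w, 't) ext_data \<Rightarrow> bool"
  where "ext_equiv F W = (\<lambda>(T, \<iota>, \<mu>) (T', \<iota>', \<mu>').
    \<exists>\<phi>\<in>kv_hom F T T'. bij_betw \<phi> (carrier T) (carrier T') \<and>
      (\<forall>w\<in>carrier W. \<phi> (\<iota> w) = \<iota>' w) \<and> (\<forall>t\<in>carrier T. \<mu>' (\<phi> t) = \<mu> t))"

definition splittable_extensions ::
  "('f, 'm) ring_scheme \<Rightarrow> ('f, 'a, 'n) module_scheme \<Rightarrow> ('f, 'a, 'w, 'k) kvmod_scheme
    \<Rightarrow> ('f, 'a, 'w, 't) ext_data set"
  where "splittable_extensions F A W = {E. extension F A W E \<and> splittable F W E}"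

definition ext_equiv_rel ::
  "('f, 'm) ring_scheme \<Rightarrow> ('f, 'a, 'n) module_scheme \<Rightarrow> ('f, 'a, 'w, 'k) kvmod_scheme
    \<Rightarrow> ('f, 'a, 'w, 't) ext_data rel"
  where "ext_equiv_rel F A W = {(E, E').
    E \<in> splittable_extensions F A W \<and> E' \<in> splittable_extensions F A W \<and> ext_equiv F W E E'}"

end

theory Submission
  imports Defs
begin

text \<open>
  A splittable extension $T$ has a linear section $\sigma : A \to T$. Since $\sigma(a)\sigma(b)$ and
  $\sigma(ab)$ have the same image in $A$, they differ by an element $f(a,b)$ of $W$; call the bilinear
  map $f$ a factor set of $T$. In the coordinates $(a, v) \mapsto \sigma(a) + v$ the product of $T$ reads
  \[ (a, v)(b, w) = (ab,\; f(a,b) + aw + vb), \]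
  so $f$ determines $T$ up to equivalence (\<open>ext_equiv_of_common_factor_set\<close>). Conversely, this formula
  makes $A \times W$ an extension with factor set $f$ precisely when it satisfies the KV-identity.
  Given the identities of $A$ and $W$, that is the cocycle condition $\delta f = 0$
  (\<open>coboundary_2_eq_one_iff\<close>, \<open>factor_set_cocycle\<close>, \<open>kv_algebra_T\<close>).

  Any other section is $\sigma + k$ with $k : A \to W$ linear, and it has the factor set
  $f - \delta k$ (\<open>change_of_section\<close>, \<open>factor_sets_cohomologous\<close>). Equivalences transport sections and
  keep their factor sets. Hence two extensions are equivalent if and only if their factor sets are
  cohomologous (\<open>ext_equiv_iff_cohomologous\<close>). The relation ``$f$ is a factor set of $T$'' between
  extensions and cocycles therefore induces the required bijection on classes
  (\<open>bij_betw_classes\<close>).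
\<close>

\<comment> \<open>the degree \<open>1\<close> of a cochain group should not be rewritten to \<open>Suc 0\<close>\<close>
declare One_nat_def [simp del]

section \<open>Linear maps between modules\<close>

text \<open>
  The KV-identity and the module identities equate two differences. Moving the subtracted terms to
  the other side leaves equations between sums, which associativity and commutativity alone can
  rearrange; the computations below use the identities in this form.
\<close>

lemma (in abelian_group) minus_eq_minus_iff:
  assumes "x \<in> carrier G" "y \<in> carrier G" "z \<in> carrier G" "w \<in> carrier G"
  shows "x \<ominus> y = z \<ominus> w \<longleftrightarrow> x \<oplus> w = z \<oplus> y"
proof -
  have cancel: "(u \<ominus> v) \<oplus> (v \<oplus> t) = u \<oplus> t"
    if "u \<in> carrier G" "v \<in> carrier G" "t \<in> carrier G" for u v t
  proof -
    have "(u \<ominus> v) \<oplus> (v \<oplus> t) = u \<oplus> ((\<ominus> v \<oplus> v) \<oplus> t)"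
      using that unfolding a_minus_def by (simp only: a_assoc a_inv_closed a_closed)
    then show ?thesis using that by (simp add: l_neg)
  qed
  have "x \<ominus> y = z \<ominus> w \<longleftrightarrow> (x \<ominus> y) \<oplus> (y \<oplus> w) = (z \<ominus> w) \<oplus> (y \<oplus> w)"
    using assms by (simp only: add.right_cancel minus_closed a_closed)
  also have "\<dots> \<longleftrightarrow> x \<oplus> w = z \<oplus> y"
    using assms cancel[of x y w] cancel[of z w y] by (simp only: a_comm[of y w])
  finally show ?thesis .
qed

lemma linear_mapI:
  assumes "\<And>x. x \<in> carrier V \<Longrightarrow> f x \<in> carrier W"
    and "\<And>x y. \<lbrakk>x \<in> carrier V; y \<in> carrier V\<rbrakk> \<Longrightarrow> f (x \<oplus>\<^bsub>V\<^esub> y) = f x \<oplus>\<^bsub>W\<^esub> f y"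
    and "\<And>c x. \<lbrakk>c \<in> carrier F; x \<in> carrier V\<rbrakk> \<Longrightarrow> f (c \<odot>\<^bsub>V\<^esub> x) = c \<odot>\<^bsub>W\<^esub> f x"
  shows "linear_map F V W f"
  using assms by (simp add: linear_map_def)

lemma
  assumes "linear_map F V W f"
  shows linear_map_closed: "x \<in> carrier V \<Longrightarrow> f x \<in> carrier W"
    and linear_map_add:
      "\<lbrakk>x \<in> carrier V; y \<in> carrier V\<rbrakk> \<Longrightarrow> f (x \<oplus>\<^bsub>V\<^esub> y) = f x \<oplus>\<^bsub>W\<^esub> f y"
    and linear_map_smult:
      "\<lbrakk>c \<in> carrier F; x \<in> carrier V\<rbrakk> \<Longrightarrow> f (c \<odot>\<^bsub>V\<^esub> x) = c \<odot>\<^bsub>W\<^esub> f x"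
  using assms by (auto simp: linear_map_def)

lemma linear_map_cong:
  assumes "module F V" "\<And>x. x \<in> carrier V \<Longrightarrow> f x = g x"
  shows "linear_map F V W f \<longleftrightarrow> linear_map F V W g"
proof -
  interpret module F V by fact
  show ?thesis using assms(2) by (auto simp: linear_map_def Pi_def)
qed

lemma linear_map_comp:
  "\<lbrakk>linear_map F V W f; linear_map F U V g\<rbrakk> \<Longrightarrow> linear_map F U W (\<lambda>x. f (g x))"
  by (auto simp: linear_map_def Pi_def)

lemma linear_map_zero:
  assumes "module F V" "module F W" "linear_map F V W f"
  shows "f \<zero>\<^bsub>V\<^esub> = \<zero>\<^bsub>W\<^esub>"
proof -
  interpret V: module F V by fact
  interpret W: module F W by fact
  have "f (\<zero>\<^bsub>F\<^esub> \<odot>\<^bsub>V\<^esub> \<zero>\<^bsub>V\<^esub>) = \<zero>\<^bsub>F\<^esub> \<odot>\<^bsub>W\<^esub> f \<zero>\<^bsub>V\<^esub>"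
    using assms(3) by (intro linear_map_smult) auto
  then show ?thesis using linear_map_closed[OF assms(3)] by simp
qed

lemma linear_map_minus:
  assumes "module F V" "module F W" "linear_map F V W f" "x \<in> carrier V"
  shows "f (\<ominus>\<^bsub>V\<^esub> x) = \<ominus>\<^bsub>W\<^esub> f x"
proof -
  interpret V: module F V by fact
  interpret W: module F W by fact
  have "f ((\<ominus>\<^bsub>F\<^esub> \<one>\<^bsub>F\<^esub>) \<odot>\<^bsub>V\<^esub> x) = (\<ominus>\<^bsub>F\<^esub> \<one>\<^bsub>F\<^esub>) \<odot>\<^bsub>W\<^esub> f x"
    using assms(3,4) by (intro linear_map_smult) auto
  then show ?thesis
    using linear_map_closed[OF assms(3)] assms(4) by (simp add: V.smult_l_minus W.smult_l_minus)
qed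

lemma linear_map_sum:
  assumes "module F W" "linear_map F V W f" "linear_map F V W g"
  shows "linear_map F V W (\<lambda>x. f x \<oplus>\<^bsub>W\<^esub> g x)"
proof -
  interpret W: module F W by fact
  note closed = linear_map_closed[OF assms(2)] linear_map_closed[OF assms(3)]
  show ?thesis
    by (rule linear_mapI)
      (simp_all add: closed linear_map_add[OF assms(2)] linear_map_add[OF assms(3)]
        linear_map_smult[OF assms(2)] linear_map_smult[OF assms(3)] W.a_ac W.smult_r_distr)
qed

lemma linear_map_neg:
  assumes "module F W" "linear_map F V W f"
  shows "linear_map F V W (\<lambda>x. \<ominus>\<^bsub>W\<^esub> f x)"
proof -
  interpret W: module F W by fact
  note closed = linear_map_closed[OF assms(2)]
  show ?thesis
    by (rule linear_mapI)
      (simp_all add: closed linear_map_add[OF assms(2)]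
        linear_map_smult[OF assms(2)] W.minus_add W.smult_r_minus)
qed

lemma linear_map_diff:
  assumes "module F W" "linear_map F V W f" "linear_map F V W g"
  shows "linear_map F V W (\<lambda>x. f x \<ominus>\<^bsub>W\<^esub> g x)"
  unfolding a_minus_def by (intro linear_map_sum linear_map_neg assms)

lemma linear_map_const_zero:
  assumes "module F W"
  shows "linear_map F V W (\<lambda>x. \<zero>\<^bsub>W\<^esub>)"
proof -
  interpret W: module F W by fact
  show ?thesis by (rule linear_mapI) auto
qed

lemma linear_map_id: "linear_map F V V (\<lambda>x. x)"
  by (rule linear_mapI) auto

lemma linear_map_bilinear_left:
  "bilinear_map F U V W b \<Longrightarrow> v \<in> carrier V \<Longrightarrow> linear_map F U W (\<lambda>u. b u v)"
  by (simp add: bilinear_map_def)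

lemma linear_map_bilinear_right:
  "bilinear_map F U V W b \<Longrightarrow> u \<in> carrier U \<Longrightarrow> linear_map F V W (b u)"
  by (simp add: bilinear_map_def)

section \<open>KV-algebras\<close>

context kv_algebra
begin

lemma product_closed [simp]: "\<lbrakk>a \<in> carrier A; b \<in> carrier A\<rbrakk> \<Longrightarrow> a \<otimes>\<^bsub>A\<^esub> b \<in> carrier A"
  by (rule linear_map_closed[OF linear_map_bilinear_right[OF mult_bilinear]])

lemma product_add_left:
  "\<lbrakk>a \<in> carrier A; b \<in> carrier A; c \<in> carrier A\<rbrakk> \<Longrightarrow>
    (a \<oplus>\<^bsub>A\<^esub> b) \<otimes>\<^bsub>A\<^esub> c = a \<otimes>\<^bsub>A\<^esub> c \<oplus>\<^bsub>A\<^esub> b \<otimes>\<^bsub>A\<^esub> c"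
  by (rule linear_map_add[OF linear_map_bilinear_left[OF mult_bilinear]])

lemma product_add_right:
  "\<lbrakk>a \<in> carrier A; b \<in> carrier A; c \<in> carrier A\<rbrakk> \<Longrightarrow>
    a \<otimes>\<^bsub>A\<^esub> (b \<oplus>\<^bsub>A\<^esub> c) = a \<otimes>\<^bsub>A\<^esub> b \<oplus>\<^bsub>A\<^esub> a \<otimes>\<^bsub>A\<^esub> c"
  by (rule linear_map_add[OF linear_map_bilinear_right[OF mult_bilinear]])

lemma product_smult_left:
  "\<lbrakk>c \<in> carrier F; a \<in> carrier A; b \<in> carrier A\<rbrakk> \<Longrightarrow>
    (c \<odot>\<^bsub>A\<^esub> a) \<otimes>\<^bsub>A\<^esub> b = c \<odot>\<^bsub>A\<^esub> (a \<otimes>\<^bsub>A\<^esub> b)"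
  by (rule linear_map_smult[OF linear_map_bilinear_left[OF mult_bilinear]])

lemma product_smult_right:
  "\<lbrakk>c \<in> carrier F; a \<in> carrier A; b \<in> carrier A\<rbrakk> \<Longrightarrow>
    a \<otimes>\<^bsub>A\<^esub> (c \<odot>\<^bsub>A\<^esub> b) = c \<odot>\<^bsub>A\<^esub> (a \<otimes>\<^bsub>A\<^esub> b)"
  by (rule linear_map_smult[OF linear_map_bilinear_right[OF mult_bilinear]])

lemma kv_identity:
  assumes "a \<in> carrier A" "b \<in> carrier A" "c \<in> carrier A"
  shows "(a \<otimes>\<^bsub>A\<^esub> b) \<otimes>\<^bsub>A\<^esub> c \<oplus>\<^bsub>A\<^esub> b \<otimes>\<^bsub>A\<^esub> (a \<otimes>\<^bsub>A\<^esub> c) =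
    (b \<otimes>\<^bsub>A\<^esub> a) \<otimes>\<^bsub>A\<^esub> c \<oplus>\<^bsub>A\<^esub> a \<otimes>\<^bsub>A\<^esub> (b \<otimes>\<^bsub>A\<^esub> c)"
  using associator_sym[OF assms] assms by (simp add: V.M.minus_eq_minus_iff)

lemma module_self: "module F A" ..

end

lemma kv_algebraI:
  assumes "field F" "module F A" "bilinear_map F A A A (mult A)"
    and "\<And>a b c. \<lbrakk>a \<in> carrier A; b \<in> carrier A; c \<in> carrier A\<rbrakk> \<Longrightarrow>
      (a \<otimes>\<^bsub>A\<^esub> b) \<otimes>\<^bsub>A\<^esub> c \<oplus>\<^bsub>A\<^esub> b \<otimes>\<^bsub>A\<^esub> (a \<otimes>\<^bsub>A\<^esub> c) =
      (b \<otimes>\<^bsub>A\<^esub> a) \<otimes>\<^bsub>A\<^esub> c \<oplus>\<^bsub>A\<^esub> a \<otimes>\<^bsub>A\<^esub> (b \<otimes>\<^bsub>A\<^esub> c)"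
  shows "kv_algebra F A"
proof -
  interpret F: field F by fact
  interpret A: module F A by fact
  have cl: "a \<otimes>\<^bsub>A\<^esub> b \<in> carrier A" if "a \<in> carrier A" "b \<in> carrier A" for a b
    using linear_map_closed[OF linear_map_bilinear_right[OF assms(3)]] that by blast
  show ?thesis
    by unfold_locales (use assms(3,4) in \<open>simp_all add: cl A.M.minus_eq_minus_iff\<close>)
qed

section \<open>Cochains of a KV-module\<close>

lemma tuples_1: "tuples A 1 = {[a] |a. a \<in> carrier A}"
  by (auto simp: tuples_def length_Suc_conv One_nat_def)

lemma tuples_2: "tuples A 2 = {[a, b] |a b. a \<in> carrier A \<and> b \<in> carrier A}"
  by (auto simp: tuples_def length_Suc_conv numeral_2_eq_2)

lemma tuples_3:
  "tuples A 3 = {[a, b, c] |a b c. a \<in> carrier A \<and> b \<in> carrier A \<and> c \<in> carrier A}"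
  by (auto simp: tuples_def length_Suc_conv numeral_3_eq_3)

lemma multilinear_maps_1:
  "f \<in> multilinear_maps F A W 1 \<longleftrightarrow>
    f \<in> extensional (tuples A 1) \<and> linear_map F A W (\<lambda>a. f [a])" (is "?L \<longleftrightarrow> ?R")
proof
  assume ?L
  show ?R
  proof
    show "f \<in> extensional (tuples A 1)" using \<open>?L\<close> by (simp add: multilinear_maps_def PiE_def)
    show "linear_map F A W (\<lambda>a. f [a])"
    proof (cases "carrier A = {}")
      case True
      then show ?thesis by (simp add: linear_map_def) 
    next
      case False
      then obtain a where "a \<in> carrier A" by blast
      then have "[a] \<in> tuples A 1" by (simp add: tuples_def)
      with \<open>?L\<close> have "linear_map F A W (\<lambda>x. f ([a][0 := x]))"
        unfolding multilinear_maps_def by blast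
      then show ?thesis by simp
    qed
  qed
next
  assume ?R
  then show ?L
    by (auto simp: multilinear_maps_def PiE_def tuples_1 dest: linear_map_closed)
qed

lemma multilinear_maps_2:
  "f \<in> multilinear_maps F A W 2 \<longleftrightarrow>
    f \<in> extensional (tuples A 2) \<and> bilinear_map F A A W (\<lambda>a b. f [a, b])" (is "?L \<longleftrightarrow> ?R")
proof
  assume ?L
  have lin: "linear_map F A W (\<lambda>x. f ([a, b][i := x]))"
    if "a \<in> carrier A" "b \<in> carrier A" "i < 2" for a b i
  proof -
    have "[a, b] \<in> tuples A 2" using that by (simp add: tuples_def)
    then show ?thesis using \<open>?L\<close> that(3) unfolding multilinear_maps_def by blast
  qed
  show ?R
    using \<open>?L\<close> lin[where i = 0] lin[where i = 1]
    by (auto simp: multilinear_maps_def PiE_def bilinear_map_def One_nat_def)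
next
  assume ?R
  then show ?L
    by (auto simp: multilinear_maps_def PiE_def tuples_2 less_2_cases_iff bilinear_map_def
        dest: linear_map_closed)
qed

lemma cochain_ext:
  assumes "f \<in> multilinear_maps F A W q" "g \<in> multilinear_maps F A W q"
    and "\<And>as. as \<in> tuples A q \<Longrightarrow> f as = g as"
  shows "f = g"
  using assms by (auto simp: multilinear_maps_def intro: PiE_ext)

context kv_module
begin

lemma module_W: "module F W" ..

lemma lact_closed [simp]: "\<lbrakk>a \<in> carrier A; w \<in> carrier W\<rbrakk> \<Longrightarrow> lact W a w \<in> carrier W"
  by (rule linear_map_closed[OF linear_map_bilinear_right[OF lact_bilinear]])

lemma lact_add_left:
  "\<lbrakk>a \<in> carrier A; b \<in> carrier A; w \<in> carrier W\<rbrakk> \<Longrightarrow>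
    lact W (a \<oplus>\<^bsub>A\<^esub> b) w = lact W a w \<oplus>\<^bsub>W\<^esub> lact W b w"
  by (rule linear_map_add[OF linear_map_bilinear_left[OF lact_bilinear]])

lemma lact_add_right:
  "\<lbrakk>a \<in> carrier A; v \<in> carrier W; w \<in> carrier W\<rbrakk> \<Longrightarrow>
    lact W a (v \<oplus>\<^bsub>W\<^esub> w) = lact W a v \<oplus>\<^bsub>W\<^esub> lact W a w"
  by (rule linear_map_add[OF linear_map_bilinear_right[OF lact_bilinear]])

lemma lact_smult_left:
  "\<lbrakk>c \<in> carrier F; a \<in> carrier A; w \<in> carrier W\<rbrakk> \<Longrightarrow>
    lact W (c \<odot>\<^bsub>A\<^esub> a) w = c \<odot>\<^bsub>W\<^esub> lact W a w"
  by (rule linear_map_smult[OF linear_map_bilinear_left[OF lact_bilinear]])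

lemma lact_smult_right:
  "\<lbrakk>c \<in> carrier F; a \<in> carrier A; w \<in> carrier W\<rbrakk> \<Longrightarrow>
    lact W a (c \<odot>\<^bsub>W\<^esub> w) = c \<odot>\<^bsub>W\<^esub> lact W a w"
  by (rule linear_map_smult[OF linear_map_bilinear_right[OF lact_bilinear]])

lemma ract_closed [simp]: "\<lbrakk>w \<in> carrier W; a \<in> carrier A\<rbrakk> \<Longrightarrow> ract W w a \<in> carrier W"
  by (rule linear_map_closed[OF linear_map_bilinear_right[OF ract_bilinear]])

lemma ract_add_left:
  "\<lbrakk>v \<in> carrier W; w \<in> carrier W; a \<in> carrier A\<rbrakk> \<Longrightarrow>
    ract W (v \<oplus>\<^bsub>W\<^esub> w) a = ract W v a \<oplus>\<^bsub>W\<^esub> ract W w a"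
  by (rule linear_map_add[OF linear_map_bilinear_left[OF ract_bilinear]])

lemma ract_add_right:
  "\<lbrakk>w \<in> carrier W; a \<in> carrier A; b \<in> carrier A\<rbrakk> \<Longrightarrow>
    ract W w (a \<oplus>\<^bsub>A\<^esub> b) = ract W w a \<oplus>\<^bsub>W\<^esub> ract W w b"
  by (rule linear_map_add[OF linear_map_bilinear_right[OF ract_bilinear]])

lemma ract_smult_left:
  "\<lbrakk>c \<in> carrier F; w \<in> carrier W; a \<in> carrier A\<rbrakk> \<Longrightarrow>
    ract W (c \<odot>\<^bsub>W\<^esub> w) a = c \<odot>\<^bsub>W\<^esub> ract W w a"
  by (rule linear_map_smult[OF linear_map_bilinear_left[OF ract_bilinear]])

lemma ract_smult_right:
  "\<lbrakk>c \<in> carrier F; w \<in> carrier W; a \<in> carrier A\<rbrakk> \<Longrightarrow>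
    ract W w (c \<odot>\<^bsub>A\<^esub> a) = c \<odot>\<^bsub>W\<^esub> ract W w a"
  by (rule linear_map_smult[OF linear_map_bilinear_right[OF ract_bilinear]])

lemma left_module_identity:
  assumes "a \<in> carrier A" "b \<in> carrier A" "w \<in> carrier W"
  shows "lact W (a \<otimes>\<^bsub>A\<^esub> b) w \<oplus>\<^bsub>W\<^esub> lact W b (lact W a w) =
    lact W (b \<otimes>\<^bsub>A\<^esub> a) w \<oplus>\<^bsub>W\<^esub> lact W a (lact W b w)"
  using left_associator_sym[OF assms] assms by (simp add: W.M.minus_eq_minus_iff)

lemma mixed_module_identity:
  assumes "a \<in> carrier A" "b \<in> carrier A" "w \<in> carrier W"
  shows "ract W (lact W a w) b \<oplus>\<^bsub>W\<^esub> ract W w (a \<otimes>\<^bsub>A\<^esub> b) =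
    ract W (ract W w a) b \<oplus>\<^bsub>W\<^esub> lact W a (ract W w b)"
  using mixed_associator_sym[OF assms] assms by (simp add: W.M.minus_eq_minus_iff)

lemma cochain_1_closed:
  "\<lbrakk>f \<in> multilinear_maps F A W 1; a \<in> carrier A\<rbrakk> \<Longrightarrow> f [a] \<in> carrier W"
  by (auto simp only: multilinear_maps_1 dest: linear_map_closed)

lemma cochain_2_closed:
  "\<lbrakk>f \<in> multilinear_maps F A W 2; a \<in> carrier A; b \<in> carrier A\<rbrakk> \<Longrightarrow> f [a, b] \<in> carrier W"
  by (auto simp: multilinear_maps_2 bilinear_map_def dest: linear_map_closed)

lemma sum_2_cochains:
  assumes "a \<in> carrier A" "b \<in> carrier A"
  shows "(f \<otimes>\<^bsub>cochain_group F A W 2\<^esub> g) [a, b] = f [a, b] \<oplus>\<^bsub>W\<^esub> g [a, b]"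
  using assms by (simp add: cochain_group_def tuples_2)

lemma coboundary_1_apply:
  assumes "f \<in> multilinear_maps F A W 1" "a \<in> carrier A" "b \<in> carrier A"
  shows "coboundary F A W 1 f [a, b] =
    \<ominus>\<^bsub>W\<^esub> (lact W a (f [b]) \<ominus>\<^bsub>W\<^esub> f [a \<otimes>\<^bsub>A\<^esub> b] \<oplus>\<^bsub>W\<^esub> ract W (f [a]) b)"
proof -
  note closed = cochain_1_closed[OF assms(1)]
  have "{..<length [b]} = {0}" by auto
  then have act: "cochain_act A W a f [b] = lact W a (f [b]) \<ominus>\<^bsub>W\<^esub> f [a \<otimes>\<^bsub>A\<^esub> b]"
    using assms closed by (simp add: cochain_act_def)
  have omits: "omit 1 [a, b] = [b]" "omit 1 [a] = []" "[a, b] ! (1 - 1) = a"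
    by (simp_all add: omit_def One_nat_def)
  have "[a, b] \<in> tuples A (1 + 1)" using assms by (simp add: tuples_def)
  moreover have "{1..1} = {1::nat}" by auto
  moreover have "(\<ominus>\<^bsub>F\<^esub> \<one>\<^bsub>F\<^esub>) [^]\<^bsub>F\<^esub> (1::nat) = \<ominus>\<^bsub>F\<^esub> \<one>\<^bsub>F\<^esub>"
    by (simp add: One_nat_def)
  ultimately show ?thesis
    using assms closed by (simp add: coboundary_def omits act W.smult_l_minus)
qed

lemma coboundary_2_apply:
  assumes f: "f \<in> multilinear_maps F A W 2"
    and "a \<in> carrier A" "b \<in> carrier A" "c \<in> carrier A"
  shows "coboundary F A W 2 f [a, b, c] =
    (lact W b (f [a, c]) \<ominus>\<^bsub>W\<^esub> (f [b \<otimes>\<^bsub>A\<^esub> a, c] \<oplus>\<^bsub>W\<^esub> f [a, b \<otimes>\<^bsub>A\<^esub> c]) \<oplus>\<^bsub>W\<^esub> ract W (f [a, b]) c) \<ominus>\<^bsub>W\<^esub>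
    (lact W a (f [b, c]) \<ominus>\<^bsub>W\<^esub> (f [a \<otimes>\<^bsub>A\<^esub> b, c] \<oplus>\<^bsub>W\<^esub> f [b, a \<otimes>\<^bsub>A\<^esub> c]) \<oplus>\<^bsub>W\<^esub> ract W (f [b, a]) c)"
proof -
  note closed = cochain_2_closed[OF f]
  have act: "cochain_act A W x f [u, v] =
      lact W x (f [u, v]) \<ominus>\<^bsub>W\<^esub> (f [x \<otimes>\<^bsub>A\<^esub> u, v] \<oplus>\<^bsub>W\<^esub> f [u, x \<otimes>\<^bsub>A\<^esub> v])"
    if "x \<in> carrier A" "u \<in> carrier A" "v \<in> carrier A" for x u v
  proof -
    have "{..<length [u, v]} = {0, Suc 0}" by auto
    then show ?thesis using that closed by (simp add: cochain_act_def)
  qed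
  have omits: "omit 1 [a, b, c] = [b, c]" "omit 2 [a, b, c] = [a, c]"
    "omit 1 [a, b] = [b]" "omit 2 [a, b] = [a]"
    by (simp_all add: omit_def eval_nat_numeral One_nat_def)
  have nths: "[a, b, c] ! (1 - 1) = a" "[a, b, c] ! (2 - 1) = b"
    by (simp_all add: One_nat_def)
  have "[a, b, c] \<in> tuples A (2 + 1)" using assms by (simp add: tuples_def)
  moreover have "{1..2} = {1, 2::nat}" by auto
  moreover have "(\<ominus>\<^bsub>F\<^esub> \<one>\<^bsub>F\<^esub>) [^]\<^bsub>F\<^esub> (2::nat) = \<one>\<^bsub>F\<^esub>" "(\<ominus>\<^bsub>F\<^esub> \<one>\<^bsub>F\<^esub>) [^]\<^bsub>F\<^esub> (1::nat) = \<ominus>\<^bsub>F\<^esub> \<one>\<^bsub>F\<^esub>"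
    by (simp_all add: numeral_2_eq_2 One_nat_def alg.K.l_minus alg.K.r_minus)
  ultimately have "coboundary F A W 2 f [a, b, c] =
      \<ominus>\<^bsub>W\<^esub> (cochain_act A W a f [b, c] \<oplus>\<^bsub>W\<^esub> ract W (f [b, a]) c) \<oplus>\<^bsub>W\<^esub>
      (cochain_act A W b f [a, c] \<oplus>\<^bsub>W\<^esub> ract W (f [a, b]) c)"
    using assms closed
    by (simp add: coboundary_def omits nths act W.smult_l_minus)
  then show ?thesis
    using assms closed by (simp add: act a_minus_def W.a_comm)
qed

text \<open>
  The right-hand side compares one expression at \<open>(a, b, c)\<close> and at \<open>(b, a, c)\<close>. It is the symmetry
  in \<open>a\<close>, \<open>b\<close> of the $W$-component of the associator $(\sigma a, \sigma b, \sigma c)$ in an extension with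
  factor set \<open>f\<close>, with the subtracted terms moved across; this is why factor sets are cocycles and
  why cocycles define KV-algebras.
\<close>

lemma coboundary_2_eq_one_iff:
  assumes f: "f \<in> multilinear_maps F A W 2"
  shows "coboundary F A W 2 f = \<one>\<^bsub>cochain_group F A W 3\<^esub> \<longleftrightarrow>
    (\<forall>a\<in>carrier A. \<forall>b\<in>carrier A. \<forall>c\<in>carrier A.
      lact W b (f [a, c]) \<oplus>\<^bsub>W\<^esub> ract W (f [a, b]) c \<oplus>\<^bsub>W\<^esub> (f [a \<otimes>\<^bsub>A\<^esub> b, c] \<oplus>\<^bsub>W\<^esub> f [b, a \<otimes>\<^bsub>A\<^esub> c]) =
      lact W a (f [b, c]) \<oplus>\<^bsub>W\<^esub> ract W (f [b, a]) c \<oplus>\<^bsub>W\<^esub> (f [b \<otimes>\<^bsub>A\<^esub> a, c] \<oplus>\<^bsub>W\<^esub> f [a, b \<otimes>\<^bsub>A\<^esub> c]))"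
    (is "_ \<longleftrightarrow> (\<forall>a\<in>_. \<forall>b\<in>_. \<forall>c\<in>_. ?lhs a b c = ?rhs a b c)")
proof -
  have "coboundary F A W 2 f = \<one>\<^bsub>cochain_group F A W 3\<^esub> \<longleftrightarrow>
      (\<forall>as\<in>tuples A 3. coboundary F A W 2 f as = \<zero>\<^bsub>W\<^esub>)"
    by (auto simp: coboundary_def cochain_group_def fun_eq_iff restrict_def)
  also have "\<dots> \<longleftrightarrow> (\<forall>a\<in>carrier A. \<forall>b\<in>carrier A. \<forall>c\<in>carrier A.
      coboundary F A W 2 f [a, b, c] = \<zero>\<^bsub>W\<^esub>)"
    unfolding tuples_3 by blast
  also have "\<dots> \<longleftrightarrow> (\<forall>a\<in>carrier A. \<forall>b\<in>carrier A. \<forall>c\<in>carrier A. ?lhs a b c = ?rhs a b c)"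
  proof (intro ball_cong refl)
    fix a b c assume abc: "a \<in> carrier A" "b \<in> carrier A" "c \<in> carrier A"
    have shift: "x \<ominus>\<^bsub>W\<^esub> y \<oplus>\<^bsub>W\<^esub> z = (x \<oplus>\<^bsub>W\<^esub> z) \<ominus>\<^bsub>W\<^esub> y"
      if "x \<in> carrier W" "y \<in> carrier W" "z \<in> carrier W" for x y z
      using that by (simp add: a_minus_def W.a_ac)
    have zero: "x \<ominus>\<^bsub>W\<^esub> y = \<zero>\<^bsub>W\<^esub> \<longleftrightarrow> x = y" if "x \<in> carrier W" "y \<in> carrier W" for x y
      using that W.M.minus_eq_minus_iff[of x y y y] by (simp add: a_minus_def W.M.r_neg W.M.add.right_cancel)
    show "coboundary F A W 2 f [a, b, c] = \<zero>\<^bsub>W\<^esub> \<longleftrightarrow> ?lhs a b c = ?rhs a b c"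
      using abc cochain_2_closed[OF f]
      by (simp add: coboundary_2_apply[OF f] shift zero W.M.minus_eq_minus_iff)
  qed
  finally show ?thesis .
qed

lemma coboundary_1_in_cochains:
  assumes k: "k \<in> multilinear_maps F A W 1"
  shows "coboundary F A W 1 k \<in> multilinear_maps F A W 2"
proof -
  have lin: "linear_map F A W (\<lambda>a. k [a])" using k by (simp only: multilinear_maps_1)
  have "linear_map F A W (\<lambda>b. coboundary F A W 1 k [a, b])" if a: "a \<in> carrier A" for a
  proof (subst linear_map_cong[OF alg.module_self coboundary_1_apply[OF k a]])
    note linear_map_comp[OF linear_map_bilinear_right[OF lact_bilinear a] lin]
      linear_map_comp[OF lin linear_map_bilinear_right[OF alg.mult_bilinear a]]
      linear_map_bilinear_right[OF ract_bilinear cochain_1_closed[OF k a]]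
    then show "linear_map F A W (\<lambda>b. \<ominus>\<^bsub>W\<^esub> (lact W a (k [b]) \<ominus>\<^bsub>W\<^esub> k [a \<otimes>\<^bsub>A\<^esub> b] \<oplus>\<^bsub>W\<^esub> ract W (k [a]) b))"
      by (intro linear_map_neg linear_map_sum linear_map_diff module_W)
  qed
  moreover have "linear_map F A W (\<lambda>a. coboundary F A W 1 k [a, b])" if b: "b \<in> carrier A" for b
  proof (subst linear_map_cong[OF alg.module_self coboundary_1_apply[OF k _ b]])
    note linear_map_bilinear_left[OF lact_bilinear cochain_1_closed[OF k b]]
      linear_map_comp[OF lin linear_map_bilinear_left[OF alg.mult_bilinear b]]
      linear_map_comp[OF linear_map_bilinear_left[OF ract_bilinear b] lin]
    then show "linear_map F A W (\<lambda>a. \<ominus>\<^bsub>W\<^esub> (lact W a (k [b]) \<ominus>\<^bsub>W\<^esub> k [a \<otimes>\<^bsub>A\<^esub> b] \<oplus>\<^bsub>W\<^esub> ract W (k [a]) b))"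
      by (intro linear_map_neg linear_map_sum linear_map_diff module_W)
  qed
  moreover have "coboundary F A W 1 k \<in> extensional (tuples A 2)"
    by (simp add: coboundary_def)
  ultimately show ?thesis by (simp add: multilinear_maps_2 bilinear_map_def)
qed

lemma comm_group_cochains: "comm_group (cochain_group F A W q)"
proof -
  have inside: "f as \<in> carrier W" if "f \<in> multilinear_maps F A W q" "as \<in> tuples A q" for f as
    using that by (auto simp: multilinear_maps_def)
  have subst_in: "as[i := x] \<in> tuples A q" if "as \<in> tuples A q" "x \<in> carrier A" for as i x
    using that set_update_subset_insert[of as i x] by (auto simp: tuples_def)
  have mem: "(\<lambda>as\<in>tuples A q. h as) \<in> multilinear_maps F A W q"
    if "\<And>as. as \<in> tuples A q \<Longrightarrow> h as \<in> carrier W"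
      "\<And>as i. \<lbrakk>as \<in> tuples A q; i < q\<rbrakk> \<Longrightarrow> linear_map F A W (\<lambda>x. h (as[i := x]))" for h
    unfolding multilinear_maps_def
  proof (intro CollectI conjI ballI allI impI)
    fix as i assume as: "as \<in> tuples A q" "i < q"
    show "linear_map F A W (\<lambda>x. (\<lambda>as\<in>tuples A q. h as) (as[i := x]))"
      using that(2)[OF as] by (subst linear_map_cong[OF alg.module_self]) (auto simp: subst_in as)
  qed (use that(1) in auto)
  have lin: "linear_map F A W (\<lambda>x. f (as[i := x]))"
    if "f \<in> multilinear_maps F A W q" "as \<in> tuples A q" "i < q" for f as i
    using that by (simp add: multilinear_maps_def)
  have carrier: "carrier (cochain_group F A W q) = multilinear_maps F A W q"
    and mult: "f \<otimes>\<^bsub>cochain_group F A W q\<^esub> g = (\<lambda>as\<in>tuples A q. f as \<oplus>\<^bsub>W\<^esub> g as)"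
    and one: "\<one>\<^bsub>cochain_group F A W q\<^esub> = (\<lambda>as\<in>tuples A q. \<zero>\<^bsub>W\<^esub>)" for f g
    by (simp_all add: cochain_group_def)
  show ?thesis
  proof (rule comm_groupI, unfold carrier mult one)
    fix f g assume fg: "f \<in> multilinear_maps F A W q" "g \<in> multilinear_maps F A W q"
    show "(\<lambda>as\<in>tuples A q. f as \<oplus>\<^bsub>W\<^esub> g as) \<in> multilinear_maps F A W q"
      using fg by (intro mem linear_map_sum[OF module_W] lin) (simp_all add: inside)
    show "(\<lambda>as\<in>tuples A q. f as \<oplus>\<^bsub>W\<^esub> g as) = (\<lambda>as\<in>tuples A q. g as \<oplus>\<^bsub>W\<^esub> f as)"
      using fg by (intro restrict_ext W.a_comm inside)
    fix h assume h: "h \<in> multilinear_maps F A W q"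
    show "(\<lambda>as\<in>tuples A q. (\<lambda>as\<in>tuples A q. f as \<oplus>\<^bsub>W\<^esub> g as) as \<oplus>\<^bsub>W\<^esub> h as) =
        (\<lambda>as\<in>tuples A q. f as \<oplus>\<^bsub>W\<^esub> (\<lambda>as\<in>tuples A q. g as \<oplus>\<^bsub>W\<^esub> h as) as)"
      using fg h by (intro restrict_ext) (simp add: inside W.a_assoc)
  next
    show "(\<lambda>as\<in>tuples A q. \<zero>\<^bsub>W\<^esub>) \<in> multilinear_maps F A W q"
      by (intro mem linear_map_const_zero[OF module_W]) simp
  next
    fix f assume f: "f \<in> multilinear_maps F A W q"
    then have "(\<lambda>as\<in>tuples A q. (\<lambda>as\<in>tuples A q. \<zero>\<^bsub>W\<^esub>) as \<oplus>\<^bsub>W\<^esub> f as) = restrict f (tuples A q)"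
      by (intro restrict_ext) (simp add: inside)
    also have "\<dots> = f"
      using f by (simp add: multilinear_maps_def PiE_def extensional_restrict)
    finally show "(\<lambda>as\<in>tuples A q. (\<lambda>as\<in>tuples A q. \<zero>\<^bsub>W\<^esub>) as \<oplus>\<^bsub>W\<^esub> f as) = f" .
    show "\<exists>g\<in>multilinear_maps F A W q. (\<lambda>as\<in>tuples A q. g as \<oplus>\<^bsub>W\<^esub> f as) = (\<lambda>as\<in>tuples A q. \<zero>\<^bsub>W\<^esub>)"
    proof
      show "(\<lambda>as\<in>tuples A q. \<ominus>\<^bsub>W\<^esub> f as) \<in> multilinear_maps F A W q"
        using f by (intro mem linear_map_neg[OF module_W] lin) (simp_all add: inside)
      show "(\<lambda>as\<in>tuples A q. (\<lambda>as\<in>tuples A q. \<ominus>\<^bsub>W\<^esub> f as) as \<oplus>\<^bsub>W\<^esub> f as) = (\<lambda>as\<in>tuples A q. \<zero>\<^bsub>W\<^esub>)"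
        using f by (intro restrict_ext) (simp add: inside W.M.l_neg)
    qed
  qed
qed

text \<open>
  Cosets of a subgroup coincide as soon as they meet; this is what turns equality of cohomology
  classes into the existence of a single 1-cochain.
\<close>

lemma subgroup_coboundaries:
  "subgroup (coboundary F A W 1 ` carrier (cochain_group F A W 1)) (cochain_group F A W 2)"
proof -
  interpret C1: comm_group "cochain_group F A W 1" by (rule comm_group_cochains)
  interpret C2: comm_group "cochain_group F A W 2" by (rule comm_group_cochains)
  have "coboundary F A W 1 \<in> hom (cochain_group F A W 1) (cochain_group F A W 2)"
  proof (rule homI)
    fix f g assume fg: "f \<in> carrier (cochain_group F A W 1)" "g \<in> carrier (cochain_group F A W 1)"
    then have C: "f \<in> multilinear_maps F A W 1" "g \<in> multilinear_maps F A W 1"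
      "f \<otimes>\<^bsub>cochain_group F A W 1\<^esub> g \<in> multilinear_maps F A W 1"
      using C1.m_closed[OF fg] by (simp_all add: cochain_group_def)
    have apply1: "(f \<otimes>\<^bsub>cochain_group F A W 1\<^esub> g) [a] = f [a] \<oplus>\<^bsub>W\<^esub> g [a]" if "a \<in> carrier A" for a
      using that by (simp add: cochain_group_def tuples_def)
    show "coboundary F A W 1 (f \<otimes>\<^bsub>cochain_group F A W 1\<^esub> g) =
        coboundary F A W 1 f \<otimes>\<^bsub>cochain_group F A W 2\<^esub> coboundary F A W 1 g"
    proof (rule cochain_ext)
      show "coboundary F A W 1 f \<otimes>\<^bsub>cochain_group F A W 2\<^esub> coboundary F A W 1 g \<in> multilinear_maps F A W 2"
        using C2.m_closed[of "coboundary F A W 1 f" "coboundary F A W 1 g"] C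
        by (simp add: cochain_group_def coboundary_1_in_cochains)
      fix as assume "as \<in> tuples A 2"
      then obtain a b where as: "as = [a, b]" and ab: "a \<in> carrier A" "b \<in> carrier A"
        by (auto simp: tuples_2)
      show "coboundary F A W 1 (f \<otimes>\<^bsub>cochain_group F A W 1\<^esub> g) as =
          (coboundary F A W 1 f \<otimes>\<^bsub>cochain_group F A W 2\<^esub> coboundary F A W 1 g) as"
        unfolding as sum_2_cochains[OF ab] coboundary_1_apply[OF C(1) ab]
          coboundary_1_apply[OF C(2) ab] coboundary_1_apply[OF C(3) ab]
        using ab cochain_1_closed[OF C(1)] cochain_1_closed[OF C(2)]
        by (simp add: apply1 lact_add_right ract_add_left a_minus_def W.M.minus_add W.a_ac)
    qed (rule coboundary_1_in_cochains[OF C(3)])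
  qed (simp add: cochain_group_def coboundary_1_in_cochains)
  then interpret \<delta>: group_hom "cochain_group F A W 1" "cochain_group F A W 2" "coboundary F A W 1"
    by unfold_locales
  show ?thesis by (rule \<delta>.img_is_subgroup)
qed

text \<open>
  The equation on the right is the one satisfied by the factor set \<open>f\<close> of a section \<open>\<sigma>\<close> and the
  factor set \<open>g\<close> of $\sigma + \iota k$: both sides are $W$-components of the product of two values of the
  new section.
\<close>

lemma cohomologous_iff:
  assumes k: "k \<in> multilinear_maps F A W 1"
    and f: "f \<in> multilinear_maps F A W 2" and g: "g \<in> multilinear_maps F A W 2"
  shows "f = coboundary F A W 1 k \<otimes>\<^bsub>cochain_group F A W 2\<^esub> g \<longleftrightarrow>
    (\<forall>a\<in>carrier A. \<forall>b\<in>carrier A.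
      f [a, b] \<oplus>\<^bsub>W\<^esub> (lact W a (k [b]) \<oplus>\<^bsub>W\<^esub> ract W (k [a]) b) = g [a, b] \<oplus>\<^bsub>W\<^esub> k [a \<otimes>\<^bsub>A\<^esub> b])"
    (is "f = ?g' \<longleftrightarrow> (\<forall>a\<in>_. \<forall>b\<in>_. ?P a b)")
proof -
  interpret C2: comm_group "cochain_group F A W 2" by (rule comm_group_cochains)
  have "?g' \<in> multilinear_maps F A W 2"
    using C2.m_closed[of "coboundary F A W 1 k" g] coboundary_1_in_cochains[OF k] g
    by (simp add: cochain_group_def)
  then have "f = ?g' \<longleftrightarrow> (\<forall>as\<in>tuples A 2. f as = ?g' as)"
    by (auto intro: cochain_ext[OF f])
  also have "\<dots> \<longleftrightarrow> (\<forall>a\<in>carrier A. \<forall>b\<in>carrier A. f [a, b] = ?g' [a, b])"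
    unfolding tuples_2 by blast
  also have "\<dots> \<longleftrightarrow> (\<forall>a\<in>carrier A. \<forall>b\<in>carrier A. ?P a b)"
  proof (intro ball_cong refl)
    fix a b assume ab: "a \<in> carrier A" "b \<in> carrier A"
    define x y z where "x = lact W a (k [b])" and "y = k [a \<otimes>\<^bsub>A\<^esub> b]" and "z = ract W (k [a]) b"
    have closed: "x \<in> carrier W" "y \<in> carrier W" "z \<in> carrier W" "f [a, b] \<in> carrier W" "g [a, b] \<in> carrier W"
      using ab cochain_1_closed[OF k] cochain_2_closed[OF f] cochain_2_closed[OF g]
      by (simp_all add: x_def y_def z_def)
    have "?g' [a, b] = (g [a, b] \<oplus>\<^bsub>W\<^esub> y) \<ominus>\<^bsub>W\<^esub> (x \<oplus>\<^bsub>W\<^esub> z)"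
      using closed unfolding sum_2_cochains[OF ab] coboundary_1_apply[OF k ab]
      by (simp add: x_def[symmetric] y_def[symmetric] z_def[symmetric] a_minus_def W.M.minus_add W.a_ac)
    moreover have "f [a, b] = f [a, b] \<ominus>\<^bsub>W\<^esub> \<zero>\<^bsub>W\<^esub>"
      using closed by (simp add: a_minus_def)
    ultimately show "f [a, b] = ?g' [a, b] \<longleftrightarrow> ?P a b"
      using closed W.M.minus_eq_minus_iff[of "f [a, b]" "\<zero>\<^bsub>W\<^esub>" "g [a, b] \<oplus>\<^bsub>W\<^esub> y" "x \<oplus>\<^bsub>W\<^esub> z"]
      by (simp add: x_def y_def z_def)
  qed
  finally show ?thesis .
qed

end

section \<open>Extensions and their linear sections\<close>

locale kv_extension = kv_module F A W + T: kv_algebra F T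
  for F :: "('f, 'm) ring_scheme" and A :: "('f, 'a, 'n) module_scheme"
    and W :: "('f, 'a, 'w, 'k) kvmod_scheme" and T :: "('f, 't) module" +
  fixes \<iota> :: "'w \<Rightarrow> 't" and \<mu> :: "'t \<Rightarrow> 'a"
  assumes \<iota>_hom: "\<iota> \<in> kv_hom F (trivial_kv W) T"
    and \<mu>_hom: "\<mu> \<in> kv_hom F T A"
    and \<iota>_inj: "inj_on \<iota> (carrier W)"
    and exact: "\<iota> ` carrier W = a_kernel T A \<mu>"
    and \<mu>_surj: "\<mu> ` carrier T = carrier A"
    and actions: "\<And>t w. \<lbrakk>t \<in> carrier T; w \<in> carrier W\<rbrakk> \<Longrightarrow>
      t \<otimes>\<^bsub>T\<^esub> \<iota> w = \<iota> (lact W (\<mu> t) w) \<and> \<iota> w \<otimes>\<^bsub>T\<^esub> t = \<iota> (ract W w (\<mu> t))"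

lemma (in kv_module) extension_iff_kv_extension:
  "extension F A W (T, \<iota>, \<mu>) \<longleftrightarrow> kv_extension F A W T \<iota> \<mu>"
  using kv_module_axioms
  by (auto simp: extension_def kv_extension_def kv_extension_axioms_def)

context kv_extension
begin

lemma \<iota>_linear: "linear_map F W T \<iota>"
  using \<iota>_hom by (simp add: kv_hom_def trivial_kv_def linear_map_def)

lemma \<mu>_linear: "linear_map F T A \<mu>"
  using \<mu>_hom by (simp add: kv_hom_def)

lemma \<iota>_closed [simp]: "w \<in> carrier W \<Longrightarrow> \<iota> w \<in> carrier T"
  by (rule linear_map_closed[OF \<iota>_linear])

lemma \<mu>_closed [simp]: "t \<in> carrier T \<Longrightarrow> \<mu> t \<in> carrier A"
  by (rule linear_map_closed[OF \<mu>_linear])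

lemma \<iota>_zero: "\<iota> \<zero>\<^bsub>W\<^esub> = \<zero>\<^bsub>T\<^esub>"
  by (rule linear_map_zero[OF module_W T.module_self \<iota>_linear])

lemmas \<iota>_add = linear_map_add[OF \<iota>_linear]
lemmas \<iota>_smult = linear_map_smult[OF \<iota>_linear]
lemmas \<mu>_add = linear_map_add[OF \<mu>_linear]
lemmas \<mu>_smult = linear_map_smult[OF \<mu>_linear]

lemma \<mu>_mult: "\<lbrakk>s \<in> carrier T; t \<in> carrier T\<rbrakk> \<Longrightarrow> \<mu> (s \<otimes>\<^bsub>T\<^esub> t) = \<mu> s \<otimes>\<^bsub>A\<^esub> \<mu> t"
  using \<mu>_hom by (simp add: kv_hom_def)

lemma \<iota>_eq_iff: "\<lbrakk>v \<in> carrier W; w \<in> carrier W\<rbrakk> \<Longrightarrow> \<iota> v = \<iota> w \<longleftrightarrow> v = w"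
  using \<iota>_inj by (simp add: inj_on_eq_iff)

lemma \<mu>_\<iota> [simp]: "w \<in> carrier W \<Longrightarrow> \<mu> (\<iota> w) = \<zero>\<^bsub>A\<^esub>"
  using exact by (auto simp: a_kernel_def')

lemma kernel_\<mu>: "\<lbrakk>t \<in> carrier T; \<mu> t = \<zero>\<^bsub>A\<^esub>\<rbrakk> \<Longrightarrow> \<exists>w\<in>carrier W. t = \<iota> w"
  using exact by (auto simp: a_kernel_def')

lemma mult_\<iota>: "\<lbrakk>t \<in> carrier T; w \<in> carrier W\<rbrakk> \<Longrightarrow> t \<otimes>\<^bsub>T\<^esub> \<iota> w = \<iota> (lact W (\<mu> t) w)"
  and \<iota>_mult: "\<lbrakk>t \<in> carrier T; w \<in> carrier W\<rbrakk> \<Longrightarrow> \<iota> w \<otimes>\<^bsub>T\<^esub> t = \<iota> (ract W w (\<mu> t))"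
  using actions by auto

lemma \<iota>_mult_\<iota>:
  assumes "v \<in> carrier W" "w \<in> carrier W"
  shows "\<iota> v \<otimes>\<^bsub>T\<^esub> \<iota> w = \<zero>\<^bsub>T\<^esub>"
proof -
  have "\<forall>v\<in>carrier W. \<forall>w\<in>carrier W. \<iota> \<zero>\<^bsub>W\<^esub> = \<iota> v \<otimes>\<^bsub>T\<^esub> \<iota> w"
    using \<iota>_hom[unfolded kv_hom_def trivial_kv_def, simplified] by blast
  then show ?thesis using assms \<iota>_zero by metis
qed

text \<open>
  Two points of $T$ over the same point of $A$ differ by a unique element of $W$. Factor sets,
  differences of sections and the $W$-coordinate of a point are all such displacements, so that
  their existence, uniqueness and linearity have to be proved only once.
\<close>

definition displacement :: "'t \<Rightarrow> 't \<Rightarrow> 'w"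
  where "displacement s t = inv_into (carrier W) \<iota> (t \<ominus>\<^bsub>T\<^esub> s)"

lemma displacement:
  assumes "s \<in> carrier T" "t \<in> carrier T" "\<mu> s = \<mu> t"
  shows displacement_closed: "displacement s t \<in> carrier W"
    and add_displacement: "s \<oplus>\<^bsub>T\<^esub> \<iota> (displacement s t) = t"
proof -
  have "\<mu> (t \<ominus>\<^bsub>T\<^esub> s) = \<zero>\<^bsub>A\<^esub>"
    using assms linear_map_minus[OF T.module_self alg.module_self \<mu>_linear]
    by (simp add: a_minus_def \<mu>_add alg.V.M.r_neg)
  then have "t \<ominus>\<^bsub>T\<^esub> s \<in> \<iota> ` carrier W"
    using assms kernel_\<mu>[of "t \<ominus>\<^bsub>T\<^esub> s"] by auto
  then show "displacement s t \<in> carrier W" and "s \<oplus>\<^bsub>T\<^esub> \<iota> (displacement s t) = t"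
    using assms
    by (simp_all add: displacement_def inv_into_into f_inv_into_f)
      (simp add: a_minus_def T.V.M.a_lcomm[of s t] T.V.M.r_neg)
qed

lemma displacement_unique:
  assumes "s \<in> carrier T" "w \<in> carrier W"
  shows "displacement s (s \<oplus>\<^bsub>T\<^esub> \<iota> w) = w"
proof -
  have mu: "\<mu> s = \<mu> (s \<oplus>\<^bsub>T\<^esub> \<iota> w)" using assms by (simp add: \<mu>_add)
  have "s \<oplus>\<^bsub>T\<^esub> \<iota> (displacement s (s \<oplus>\<^bsub>T\<^esub> \<iota> w)) = s \<oplus>\<^bsub>T\<^esub> \<iota> w"
    and "displacement s (s \<oplus>\<^bsub>T\<^esub> \<iota> w) \<in> carrier W"
    using assms mu by (simp_all add: add_displacement displacement_closed)
  then show ?thesis using assms by (simp add: \<iota>_eq_iff)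
qed

lemma linear_map_displacement:
  assumes V: "module F V" and p: "linear_map F V T p" and q: "linear_map F V T q"
    and eq: "\<And>x. x \<in> carrier V \<Longrightarrow> \<mu> (p x) = \<mu> (q x)"
  shows "linear_map F V W (\<lambda>x. displacement (p x) (q x))"
proof -
  interpret V: module F V by fact
  note p_closed = linear_map_closed[OF p] and q_closed = linear_map_closed[OF q]
  let ?d = "\<lambda>x. displacement (p x) (q x)"
  have d: "?d x \<in> carrier W" "p x \<oplus>\<^bsub>T\<^esub> \<iota> (?d x) = q x" if "x \<in> carrier V" for x
    using that eq by (simp_all add: displacement_closed add_displacement p_closed q_closed)
  have unique: "?d x = w" if "x \<in> carrier V" "w \<in> carrier W" "q x = p x \<oplus>\<^bsub>T\<^esub> \<iota> w" for x w
    using that by (simp add: displacement_unique p_closed)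
  show ?thesis
  proof (rule linear_mapI)
    fix x y assume xy: "x \<in> carrier V" "y \<in> carrier V"
    have "q (x \<oplus>\<^bsub>V\<^esub> y) = (p x \<oplus>\<^bsub>T\<^esub> \<iota> (?d x)) \<oplus>\<^bsub>T\<^esub> (p y \<oplus>\<^bsub>T\<^esub> \<iota> (?d y))"
      using xy by (simp add: linear_map_add[OF q] d)
    also have "\<dots> = p (x \<oplus>\<^bsub>V\<^esub> y) \<oplus>\<^bsub>T\<^esub> \<iota> (?d x \<oplus>\<^bsub>W\<^esub> ?d y)"
      using xy d(1) by (simp add: linear_map_add[OF p] \<iota>_add p_closed T.V.M.a_ac)
    finally show "?d (x \<oplus>\<^bsub>V\<^esub> y) = ?d x \<oplus>\<^bsub>W\<^esub> ?d y"
      using xy d(1) by (intro unique) auto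
  next
    fix c x assume cx: "c \<in> carrier F" "x \<in> carrier V"
    have "q (c \<odot>\<^bsub>V\<^esub> x) = c \<odot>\<^bsub>T\<^esub> (p x \<oplus>\<^bsub>T\<^esub> \<iota> (?d x))"
      using cx by (simp add: linear_map_smult[OF q] d)
    also have "\<dots> = p (c \<odot>\<^bsub>V\<^esub> x) \<oplus>\<^bsub>T\<^esub> \<iota> (c \<odot>\<^bsub>W\<^esub> ?d x)"
      using cx d(1) by (simp add: linear_map_smult[OF p] \<iota>_smult p_closed T.V.smult_r_distr)
    finally show "?d (c \<odot>\<^bsub>V\<^esub> x) = c \<odot>\<^bsub>W\<^esub> ?d x"
      using cx d(1) by (intro unique) auto
  qed (rule d)
qed

definition linear_section :: "('a \<Rightarrow> 't) \<Rightarrow> bool"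
  where "linear_section \<sigma> \<longleftrightarrow> linear_map F A T \<sigma> \<and> (\<forall>a\<in>carrier A. \<mu> (\<sigma> a) = a)"

lemma linear_sectionD:
  assumes "linear_section \<sigma>"
  shows section_linear: "linear_map F A T \<sigma>"
    and section_closed: "a \<in> carrier A \<Longrightarrow> \<sigma> a \<in> carrier T"
    and \<mu>_section: "a \<in> carrier A \<Longrightarrow> \<mu> (\<sigma> a) = a"
  using assms by (auto simp: linear_section_def dest: linear_map_closed)

lemma section_zero: "linear_section \<sigma> \<Longrightarrow> \<sigma> \<zero>\<^bsub>A\<^esub> = \<zero>\<^bsub>T\<^esub>"
  by (rule linear_map_zero[OF alg.module_self T.module_self section_linear])

text \<open>
  A complement $S$ of $W$ maps isomorphically onto $A$: it meets the kernel of \<open>\<mu>\<close> trivially, and a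
  preimage of a point of $A$ can be corrected by an element of $W$ to lie in $S$. The inverse is the
  section, linear because values in $S$ are determined by their images.
\<close>

lemma linear_section_of_splittable:
  assumes "splittable F W (T, \<iota>, \<mu>)"
  shows "\<exists>\<sigma>. linear_section \<sigma>"
proof -
  from assms obtain S where S: "submodule S F T" and disjoint: "\<iota> ` carrier W \<inter> S = {\<zero>\<^bsub>T\<^esub>}"
    and span: "\<iota> ` carrier W <+>\<^bsub>T\<^esub> S = carrier T"
    by (auto simp: splittable_def)
  note S_closed = T.V.submoduleE[OF S]
  have S_sub: "s \<in> carrier T" if "s \<in> S" for s using S_closed(1) that by auto
  have inj: "s = t" if "s \<in> S" "t \<in> S" "\<mu> s = \<mu> t" for s t
  proof -
    let ?w = "displacement t s"
    have w: "?w \<in> carrier W" "t \<oplus>\<^bsub>T\<^esub> \<iota> ?w = s"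
      using that S_sub by (simp_all add: displacement_closed add_displacement)
    have "\<ominus>\<^bsub>T\<^esub> t \<oplus>\<^bsub>T\<^esub> (t \<oplus>\<^bsub>T\<^esub> \<iota> ?w) = \<iota> ?w"
      using that(2) w(1) S_sub by (simp add: T.V.M.a_assoc[symmetric] T.V.M.l_neg)
    moreover have "\<ominus>\<^bsub>T\<^esub> t \<oplus>\<^bsub>T\<^esub> s \<in> S" using that S_closed by auto
    ultimately have "\<iota> ?w = \<zero>\<^bsub>T\<^esub>" using disjoint w by auto
    then show "s = t" using w(2) that S_sub[of t] by simp
  qed
  have "\<exists>s\<in>S. \<mu> s = a" if a: "a \<in> carrier A" for a
  proof -
    obtain t where t: "t \<in> carrier T" "\<mu> t = a" using a unfolding \<mu>_surj[symmetric] by auto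
    then have "t \<in> \<iota> ` carrier W <+>\<^bsub>T\<^esub> S" by (simp add: span)
    then obtain w s where "w \<in> carrier W" "s \<in> S" "t = \<iota> w \<oplus>\<^bsub>T\<^esub> s"
      by (auto simp: set_add_def')
    then show ?thesis using t S_sub by (auto simp: \<mu>_add intro!: bexI[of _ s])
  qed
  then obtain \<sigma> where \<sigma>: "\<And>a. a \<in> carrier A \<Longrightarrow> \<sigma> a \<in> S" "\<And>a. a \<in> carrier A \<Longrightarrow> \<mu> (\<sigma> a) = a"
    by metis
  have "linear_map F A T \<sigma>"
    by (rule linear_mapI; (rule inj)?)
      (simp_all add: \<sigma> S_sub S_closed \<mu>_add \<mu>_smult)
  then show ?thesis using \<sigma>(2) by (auto simp: linear_section_def)
qed

text \<open>
  The image of the section is the complement.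
\<close>

lemma splittable_of_linear_section:
  assumes \<sigma>: "linear_section \<sigma>"
  shows "splittable F W (T, \<iota>, \<mu>)"
proof -
  note lin = section_linear[OF \<sigma>] and closed = section_closed[OF \<sigma>]
  have "submodule (\<sigma> ` carrier A) F T"
  proof (rule T.V.submoduleI)
    show "\<zero>\<^bsub>T\<^esub> \<in> \<sigma> ` carrier A" using section_zero[OF \<sigma>, symmetric] by auto
  qed (use closed in \<open>auto simp: linear_map_add[OF lin, symmetric] linear_map_smult[OF lin, symmetric]
      linear_map_minus[OF alg.module_self T.module_self lin, symmetric]\<close>)
  moreover have "\<iota> ` carrier W \<inter> \<sigma> ` carrier A = {\<zero>\<^bsub>T\<^esub>}"
  proof (intro equalityI subsetI)
    fix t assume "t \<in> \<iota> ` carrier W \<inter> \<sigma> ` carrier A"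
    then obtain w a where "w \<in> carrier W" "t = \<iota> w" "a \<in> carrier A" "t = \<sigma> a" by auto
    then have "a = \<zero>\<^bsub>A\<^esub>" using \<mu>_section[OF \<sigma>, of a] by simp
    then show "t \<in> {\<zero>\<^bsub>T\<^esub>}" using \<open>t = \<sigma> a\<close> section_zero[OF \<sigma>] by simp
  next
    fix t assume "t \<in> {\<zero>\<^bsub>T\<^esub>}"
    then have "t = \<iota> \<zero>\<^bsub>W\<^esub>" "t = \<sigma> \<zero>\<^bsub>A\<^esub>" by (simp_all add: \<iota>_zero section_zero[OF \<sigma>])
    then show "t \<in> \<iota> ` carrier W \<inter> \<sigma> ` carrier A"
      by (metis IntI imageI W.M.zero_closed alg.V.M.zero_closed)
  qed
  moreover have "\<iota> ` carrier W <+>\<^bsub>T\<^esub> \<sigma> ` carrier A = carrier T"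
  proof (intro equalityI subsetI)
    fix t assume t: "t \<in> carrier T"
    let ?w = "displacement (\<sigma> (\<mu> t)) t"
    have "?w \<in> carrier W" "\<iota> ?w \<oplus>\<^bsub>T\<^esub> \<sigma> (\<mu> t) = t"
      using displacement[of "\<sigma> (\<mu> t)" t] t closed \<mu>_section[OF \<sigma>]
      by (simp_all add: T.V.M.a_comm)
    then show "t \<in> \<iota> ` carrier W <+>\<^bsub>T\<^esub> \<sigma> ` carrier A"
      using t unfolding set_add_def' by (auto intro!: bexI[of _ ?w] bexI[of _ "\<mu> t"])
  qed (use closed in \<open>auto simp: set_add_def'\<close>)
  ultimately show ?thesis by (auto simp: splittable_def)
qed

section \<open>Factor sets\<close>

text \<open>
  The factor set of \<open>\<sigma>\<close> measures its failure to be multiplicative.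
\<close>

definition section_factor_set :: "('a \<Rightarrow> 't) \<Rightarrow> ('a list \<Rightarrow> 'w) \<Rightarrow> bool"
  where "section_factor_set \<sigma> f \<longleftrightarrow> linear_section \<sigma> \<and> f \<in> multilinear_maps F A W 2 \<and>
    (\<forall>a\<in>carrier A. \<forall>b\<in>carrier A. \<sigma> a \<otimes>\<^bsub>T\<^esub> \<sigma> b = \<sigma> (a \<otimes>\<^bsub>A\<^esub> b) \<oplus>\<^bsub>T\<^esub> \<iota> (f [a, b]))"

lemma section_factor_setD:
  assumes "section_factor_set \<sigma> f"
  shows "linear_section \<sigma>" "f \<in> multilinear_maps F A W 2"
    "\<lbrakk>a \<in> carrier A; b \<in> carrier A\<rbrakk> \<Longrightarrow> \<sigma> a \<otimes>\<^bsub>T\<^esub> \<sigma> b = \<sigma> (a \<otimes>\<^bsub>A\<^esub> b) \<oplus>\<^bsub>T\<^esub> \<iota> (f [a, b])"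
  using assms by (auto simp: section_factor_set_def)

text \<open>
  Both $\sigma(ab)$ and $\sigma(a)\sigma(b)$ lie over $ab$, so a displacement exists. It is bilinear since
  both points depend linearly on each of \<open>a\<close> and \<open>b\<close>.
\<close>

lemma section_factor_set_exists:
  assumes \<sigma>: "linear_section \<sigma>"
  shows "\<exists>f. section_factor_set \<sigma> f"
proof -
  note lin = section_linear[OF \<sigma>] and closed = section_closed[OF \<sigma>]
  let ?d = "\<lambda>a b. displacement (\<sigma> (a \<otimes>\<^bsub>A\<^esub> b)) (\<sigma> a \<otimes>\<^bsub>T\<^esub> \<sigma> b)"
  define f where "f = (\<lambda>as\<in>tuples A 2. ?d (as ! 0) (as ! 1))"
  have f: "f [a, b] = ?d a b" if "a \<in> carrier A" "b \<in> carrier A" for a b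
    using that by (simp add: f_def tuples_def One_nat_def)
  have \<mu>: "\<mu> (\<sigma> (a \<otimes>\<^bsub>A\<^esub> b)) = \<mu> (\<sigma> a \<otimes>\<^bsub>T\<^esub> \<sigma> b)" if "a \<in> carrier A" "b \<in> carrier A" for a b
    using that by (simp add: \<mu>_mult closed \<mu>_section[OF \<sigma>])
  have "bilinear_map F A A W (\<lambda>a b. f [a, b])"
    unfolding bilinear_map_def
  proof (intro conjI ballI)
    fix a assume a: "a \<in> carrier A"
    have "linear_map F A W (\<lambda>b. ?d a b)"
      by (rule linear_map_displacement[OF alg.module_self
            linear_map_comp[OF lin linear_map_bilinear_right[OF alg.mult_bilinear a]]
            linear_map_comp[OF linear_map_bilinear_right[OF T.mult_bilinear closed[OF a]] lin] \<mu>[OF a]])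
    then show "linear_map F A W (\<lambda>b. f [a, b])"
      by (subst linear_map_cong[OF alg.module_self f[OF a]])
  next
    fix b assume b: "b \<in> carrier A"
    have "linear_map F A W (\<lambda>a. ?d a b)"
      by (rule linear_map_displacement[OF alg.module_self
            linear_map_comp[OF lin linear_map_bilinear_left[OF alg.mult_bilinear b]]
            linear_map_comp[OF linear_map_bilinear_left[OF T.mult_bilinear closed[OF b]] lin] \<mu>[OF _ b]])
    then show "linear_map F A W (\<lambda>a. f [a, b])"
      by (subst linear_map_cong[OF alg.module_self f[OF _ b]])
  qed
  then have "f \<in> multilinear_maps F A W 2"
    by (simp add: multilinear_maps_2 f_def)
  moreover have "\<sigma> a \<otimes>\<^bsub>T\<^esub> \<sigma> b = \<sigma> (a \<otimes>\<^bsub>A\<^esub> b) \<oplus>\<^bsub>T\<^esub> \<iota> (f [a, b])"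
    if "a \<in> carrier A" "b \<in> carrier A" for a b
    using that by (simp add: f add_displacement closed \<mu>)
  ultimately show ?thesis using \<sigma> by (auto simp: section_factor_set_def)
qed

text \<open>
  In the coordinates given by a section, the multiplication depends on \<open>T\<close> only through the factor
  set. The comparison of sections and of extensions, and the definition of the crossed product,
  all rest on this formula.
\<close>

lemma mult_coordinates:
  assumes f: "section_factor_set \<sigma> f"
    and ab: "a \<in> carrier A" "b \<in> carrier A" and vw: "v \<in> carrier W" "w \<in> carrier W"
  shows "(\<sigma> a \<oplus>\<^bsub>T\<^esub> \<iota> v) \<otimes>\<^bsub>T\<^esub> (\<sigma> b \<oplus>\<^bsub>T\<^esub> \<iota> w) =
    \<sigma> (a \<otimes>\<^bsub>A\<^esub> b) \<oplus>\<^bsub>T\<^esub> \<iota> (f [a, b] \<oplus>\<^bsub>W\<^esub> (lact W a w \<oplus>\<^bsub>W\<^esub> ract W v b))"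
proof -
  note \<sigma> = section_factor_setD(1)[OF f]
  note closed = section_closed[OF \<sigma>] cochain_2_closed[OF section_factor_setD(2)[OF f]]
  have "(\<sigma> a \<oplus>\<^bsub>T\<^esub> \<iota> v) \<otimes>\<^bsub>T\<^esub> (\<sigma> b \<oplus>\<^bsub>T\<^esub> \<iota> w) =
      \<sigma> a \<otimes>\<^bsub>T\<^esub> \<sigma> b \<oplus>\<^bsub>T\<^esub> (\<sigma> a \<otimes>\<^bsub>T\<^esub> \<iota> w \<oplus>\<^bsub>T\<^esub> \<iota> v \<otimes>\<^bsub>T\<^esub> \<sigma> b) \<oplus>\<^bsub>T\<^esub> \<iota> v \<otimes>\<^bsub>T\<^esub> \<iota> w"
    using ab vw closed by (simp add: T.product_add_left T.product_add_right T.V.M.a_ac)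
  also have "\<dots> = \<sigma> (a \<otimes>\<^bsub>A\<^esub> b) \<oplus>\<^bsub>T\<^esub> \<iota> (f [a, b]) \<oplus>\<^bsub>T\<^esub> \<iota> (lact W a w \<oplus>\<^bsub>W\<^esub> ract W v b)"
    unfolding \<iota>_mult_\<iota>[OF vw] using ab vw closed
    by (simp add: section_factor_setD(3)[OF f] mult_\<iota> \<iota>_mult \<mu>_section[OF \<sigma>] \<iota>_add)
  also have "\<dots> = \<sigma> (a \<otimes>\<^bsub>A\<^esub> b) \<oplus>\<^bsub>T\<^esub> \<iota> (f [a, b] \<oplus>\<^bsub>W\<^esub> (lact W a w \<oplus>\<^bsub>W\<^esub> ract W v b))"
    using ab vw closed by (simp add: \<iota>_add T.V.M.a_assoc)
  finally show ?thesis .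
qed

text \<open>
  Evaluate the KV-identity of $T$ on values of the section. Its $A$-components agree by the
  KV-identity of $A$, and the $W$-components form the cocycle identity.
\<close>

lemma factor_set_cocycle:
  assumes f: "section_factor_set \<sigma> f"
  shows "coboundary F A W 2 f = \<one>\<^bsub>cochain_group F A W 3\<^esub>"
proof -
  note \<sigma> = section_factor_setD(1)[OF f] and C = section_factor_setD(2)[OF f]
  note lin = section_linear[OF \<sigma>]
  note closed = section_closed[OF \<sigma>] cochain_2_closed[OF C]
  \<comment> \<open>the other side of the KV-identity arises by exchanging \<open>a\<close> and \<open>b\<close>\<close>
  let ?c = "\<lambda>a b c. lact W b (f [a, c]) \<oplus>\<^bsub>W\<^esub> ract W (f [a, b]) c \<oplus>\<^bsub>W\<^esub> (f [a \<otimes>\<^bsub>A\<^esub> b, c] \<oplus>\<^bsub>W\<^esub> f [b, a \<otimes>\<^bsub>A\<^esub> c])"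
  have eval: "(\<sigma> a \<otimes>\<^bsub>T\<^esub> \<sigma> b) \<otimes>\<^bsub>T\<^esub> \<sigma> c \<oplus>\<^bsub>T\<^esub> \<sigma> b \<otimes>\<^bsub>T\<^esub> (\<sigma> a \<otimes>\<^bsub>T\<^esub> \<sigma> c) =
      \<sigma> ((a \<otimes>\<^bsub>A\<^esub> b) \<otimes>\<^bsub>A\<^esub> c \<oplus>\<^bsub>A\<^esub> b \<otimes>\<^bsub>A\<^esub> (a \<otimes>\<^bsub>A\<^esub> c)) \<oplus>\<^bsub>T\<^esub> \<iota> (?c a b c)"
    if abc: "a \<in> carrier A" "b \<in> carrier A" "c \<in> carrier A" for a b c
  proof -
    have "(\<sigma> a \<otimes>\<^bsub>T\<^esub> \<sigma> b) \<otimes>\<^bsub>T\<^esub> \<sigma> c = \<sigma> ((a \<otimes>\<^bsub>A\<^esub> b) \<otimes>\<^bsub>A\<^esub> c) \<oplus>\<^bsub>T\<^esub> \<iota> (f [a \<otimes>\<^bsub>A\<^esub> b, c] \<oplus>\<^bsub>W\<^esub> ract W (f [a, b]) c)"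
      using abc closed
      by (simp add: section_factor_setD(3)[OF f] T.product_add_left \<iota>_mult \<mu>_section[OF \<sigma>] \<iota>_add T.V.M.a_assoc)
    moreover have "\<sigma> b \<otimes>\<^bsub>T\<^esub> (\<sigma> a \<otimes>\<^bsub>T\<^esub> \<sigma> c) = \<sigma> (b \<otimes>\<^bsub>A\<^esub> (a \<otimes>\<^bsub>A\<^esub> c)) \<oplus>\<^bsub>T\<^esub> \<iota> (f [b, a \<otimes>\<^bsub>A\<^esub> c] \<oplus>\<^bsub>W\<^esub> lact W b (f [a, c]))"
      using abc closed
      by (simp add: section_factor_setD(3)[OF f] T.product_add_right mult_\<iota> \<mu>_section[OF \<sigma>] \<iota>_add T.V.M.a_assoc)
    ultimately show ?thesis
      using abc closed by (simp add: linear_map_add[OF lin] \<iota>_add T.V.M.a_ac)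
  qed
  have "?c a b c = ?c b a c" if abc: "a \<in> carrier A" "b \<in> carrier A" "c \<in> carrier A" for a b c
  proof -
    let ?x = "(a \<otimes>\<^bsub>A\<^esub> b) \<otimes>\<^bsub>A\<^esub> c \<oplus>\<^bsub>A\<^esub> b \<otimes>\<^bsub>A\<^esub> (a \<otimes>\<^bsub>A\<^esub> c)"
    have in_W: "?c a b c \<in> carrier W" "?c b a c \<in> carrier W" using abc closed by simp_all
    have "\<sigma> ?x \<oplus>\<^bsub>T\<^esub> \<iota> (?c a b c) = \<sigma> ?x \<oplus>\<^bsub>T\<^esub> \<iota> (?c b a c)"
      using eval[OF abc] eval[OF abc(2,1,3)] T.kv_identity[of "\<sigma> a" "\<sigma> b" "\<sigma> c"]
        alg.kv_identity[OF abc] abc closed by simp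
    then have "displacement (\<sigma> ?x) (\<sigma> ?x \<oplus>\<^bsub>T\<^esub> \<iota> (?c a b c)) = displacement (\<sigma> ?x) (\<sigma> ?x \<oplus>\<^bsub>T\<^esub> \<iota> (?c b a c))"
      by (rule arg_cong)
    moreover have "\<sigma> ?x \<in> carrier T" using abc closed by simp
    ultimately show ?thesis using in_W by (simp only: displacement_unique)
  qed
  then show ?thesis unfolding coboundary_2_eq_one_iff[OF C] by blast
qed

text \<open>
  In the coordinates of \<open>\<sigma>\<close> the value of the new section at \<open>a\<close> is $(a, k(a))$, so that the product
  formula expresses its factor set through \<open>f\<close> and \<open>k\<close>.
\<close>

lemma change_of_section:
  assumes f: "section_factor_set \<sigma> f" and k: "k \<in> multilinear_maps F A W 1"
    and g: "g \<in> multilinear_maps F A W 2"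
    and eq: "f = coboundary F A W 1 k \<otimes>\<^bsub>cochain_group F A W 2\<^esub> g"
  shows "section_factor_set (\<lambda>a. \<sigma> a \<oplus>\<^bsub>T\<^esub> \<iota> (k [a])) g"
proof -
  note \<sigma> = section_factor_setD(1)[OF f] and C = section_factor_setD(2)[OF f]
  note closed = section_closed[OF \<sigma>] cochain_2_closed[OF C] cochain_1_closed[OF k] cochain_2_closed[OF g]
  have k_lin: "linear_map F A W (\<lambda>a. k [a])" using k by (simp add: multilinear_maps_1)
  have "linear_section (\<lambda>a. \<sigma> a \<oplus>\<^bsub>T\<^esub> \<iota> (k [a]))"
    unfolding linear_section_def
    by (auto intro!: linear_map_sum[OF T.module_self section_linear[OF \<sigma>]]
        linear_map_comp[OF \<iota>_linear k_lin] simp: \<mu>_add closed \<mu>_section[OF \<sigma>])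
  moreover have "(\<sigma> a \<oplus>\<^bsub>T\<^esub> \<iota> (k [a])) \<otimes>\<^bsub>T\<^esub> (\<sigma> b \<oplus>\<^bsub>T\<^esub> \<iota> (k [b])) =
      \<sigma> (a \<otimes>\<^bsub>A\<^esub> b) \<oplus>\<^bsub>T\<^esub> \<iota> (k [a \<otimes>\<^bsub>A\<^esub> b]) \<oplus>\<^bsub>T\<^esub> \<iota> (g [a, b])"
    if ab: "a \<in> carrier A" "b \<in> carrier A" for a b
  proof -
    have "f [a, b] \<oplus>\<^bsub>W\<^esub> (lact W a (k [b]) \<oplus>\<^bsub>W\<^esub> ract W (k [a]) b) = k [a \<otimes>\<^bsub>A\<^esub> b] \<oplus>\<^bsub>W\<^esub> g [a, b]"
      using eq ab closed unfolding cohomologous_iff[OF k C g] by (simp add: W.a_comm)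
    then show ?thesis
      using ab closed by (simp add: mult_coordinates[OF f] \<iota>_add T.V.M.a_assoc)
  qed
  ultimately show ?thesis using g by (simp add: section_factor_set_def)
qed

text \<open>
  Two sections differ by a linear map $k : A \to W$. Expanding $\tau(a)\tau(b)$ with
  $\tau = \sigma + \iota k$ in the coordinates of \<open>\<sigma>\<close>, and by the factor set of \<open>\<tau>\<close>, gives the relation
  between \<open>f\<close> and \<open>g\<close>.
\<close>

lemma factor_sets_cohomologous:
  assumes f: "section_factor_set \<sigma> f" and g: "section_factor_set \<tau> g"
  shows "\<exists>k\<in>multilinear_maps F A W 1. f = coboundary F A W 1 k \<otimes>\<^bsub>cochain_group F A W 2\<^esub> g"
proof
  note \<sigma> = section_factor_setD(1)[OF f] and Cf = section_factor_setD(2)[OF f]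
  note \<tau> = section_factor_setD(1)[OF g] and Cg = section_factor_setD(2)[OF g]
  define k where "k = (\<lambda>as\<in>tuples A 1. displacement (\<sigma> (as ! 0)) (\<tau> (as ! 0)))"
  have k_apply: "k [a] = displacement (\<sigma> a) (\<tau> a)" if "a \<in> carrier A" for a
    using that by (simp add: k_def tuples_def One_nat_def)
  have "linear_map F A W (\<lambda>a. displacement (\<sigma> a) (\<tau> a))"
    by (rule linear_map_displacement[OF alg.module_self section_linear[OF \<sigma>] section_linear[OF \<tau>]])
      (simp add: \<mu>_section[OF \<sigma>] \<mu>_section[OF \<tau>])
  then have "linear_map F A W (\<lambda>a. k [a])"
    by (subst linear_map_cong[OF alg.module_self k_apply])
  then show k: "k \<in> multilinear_maps F A W 1"
    by (simp add: multilinear_maps_1 k_def)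
  note closed = section_closed[OF \<sigma>] section_closed[OF \<tau>] cochain_2_closed[OF Cf]
    cochain_1_closed[OF k] cochain_2_closed[OF Cg]
  have \<tau>_eq: "\<tau> a = \<sigma> a \<oplus>\<^bsub>T\<^esub> \<iota> (k [a])" if "a \<in> carrier A" for a
    using that by (simp add: k_apply add_displacement closed \<mu>_section[OF \<sigma>] \<mu>_section[OF \<tau>])
  show "f = coboundary F A W 1 k \<otimes>\<^bsub>cochain_group F A W 2\<^esub> g"
    unfolding cohomologous_iff[OF k Cf Cg]
  proof (intro ballI)
    fix a b assume ab: "a \<in> carrier A" "b \<in> carrier A"
    let ?x = "f [a, b] \<oplus>\<^bsub>W\<^esub> (lact W a (k [b]) \<oplus>\<^bsub>W\<^esub> ract W (k [a]) b)"
    have "\<sigma> (a \<otimes>\<^bsub>A\<^esub> b) \<oplus>\<^bsub>T\<^esub> \<iota> ?x = \<tau> a \<otimes>\<^bsub>T\<^esub> \<tau> b"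
      using ab closed by (simp add: \<tau>_eq mult_coordinates[OF f])
    also have "\<dots> = \<sigma> (a \<otimes>\<^bsub>A\<^esub> b) \<oplus>\<^bsub>T\<^esub> \<iota> (g [a, b] \<oplus>\<^bsub>W\<^esub> k [a \<otimes>\<^bsub>A\<^esub> b])"
      using ab closed
      by (simp add: section_factor_setD(3)[OF g] \<tau>_eq[of "a \<otimes>\<^bsub>A\<^esub> b"] \<iota>_add T.V.M.a_ac)
    finally have "displacement (\<sigma> (a \<otimes>\<^bsub>A\<^esub> b)) (\<sigma> (a \<otimes>\<^bsub>A\<^esub> b) \<oplus>\<^bsub>T\<^esub> \<iota> ?x) =
        displacement (\<sigma> (a \<otimes>\<^bsub>A\<^esub> b)) (\<sigma> (a \<otimes>\<^bsub>A\<^esub> b) \<oplus>\<^bsub>T\<^esub> \<iota> (g [a, b] \<oplus>\<^bsub>W\<^esub> k [a \<otimes>\<^bsub>A\<^esub> b]))"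
      by (rule arg_cong)
    then show "?x = g [a, b] \<oplus>\<^bsub>W\<^esub> k [a \<otimes>\<^bsub>A\<^esub> b]"
      using ab closed by (simp add: displacement_unique)
  qed
qed

lemma coordinates:
  assumes \<sigma>: "linear_section \<sigma>" and t: "t \<in> carrier T"
  shows "displacement (\<sigma> (\<mu> t)) t \<in> carrier W"
    and "\<sigma> (\<mu> t) \<oplus>\<^bsub>T\<^esub> \<iota> (displacement (\<sigma> (\<mu> t)) t) = t"
  using displacement[of "\<sigma> (\<mu> t)" t] t section_closed[OF \<sigma>] \<mu>_section[OF \<sigma>] by simp_all

lemma linear_coordinates:
  assumes \<sigma>: "linear_section \<sigma>"
  shows "linear_map F T W (\<lambda>t. displacement (\<sigma> (\<mu> t)) t)"
  by (rule linear_map_displacement[OF T.module_self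
        linear_map_comp[OF section_linear[OF \<sigma>] \<mu>_linear] linear_map_id])
    (simp add: \<mu>_section[OF \<sigma>])

end

section \<open>Equivalence of extensions\<close>

text \<open>
  The isomorphism identifies points with the same coordinates; it is multiplicative because the
  product in coordinates is determined by the factor set.
\<close>

lemma (in kv_module) ext_equiv_of_common_factor_set:
  assumes "kv_extension F A W T \<iota> \<mu>" "kv_extension F A W T' \<iota>' \<mu>'"
    and f: "kv_extension.section_factor_set F A W T \<iota> \<mu> \<sigma> f"
    and f': "kv_extension.section_factor_set F A W T' \<iota>' \<mu>' \<sigma>' f"
  shows "ext_equiv F W (T, \<iota>, \<mu>) (T', \<iota>', \<mu>')"
proof -
  interpret E: kv_extension F A W T \<iota> \<mu> by fact
  interpret E': kv_extension F A W T' \<iota>' \<mu>' by fact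
  note \<sigma> = E.section_factor_setD(1)[OF f] and \<sigma>' = E'.section_factor_setD(1)[OF f']
  note closed = E.section_closed[OF \<sigma>] E'.section_closed[OF \<sigma>']
    cochain_2_closed[OF E.section_factor_setD(2)[OF f]]
  define \<pi> where "\<pi> = (\<lambda>t. E.displacement (\<sigma> (\<mu> t)) t)"
  define \<phi> where "\<phi> = (\<lambda>t. \<sigma>' (\<mu> t) \<oplus>\<^bsub>T'\<^esub> \<iota>' (\<pi> t))"
  define \<psi> where "\<psi> = (\<lambda>t. \<sigma> (\<mu>' t) \<oplus>\<^bsub>T\<^esub> \<iota> (E'.displacement (\<sigma>' (\<mu>' t)) t))"
  have \<phi>: "\<phi> (\<sigma> a \<oplus>\<^bsub>T\<^esub> \<iota> w) = \<sigma>' a \<oplus>\<^bsub>T'\<^esub> \<iota>' w" if "a \<in> carrier A" "w \<in> carrier W" for a w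
    using that closed
    by (simp add: \<phi>_def \<pi>_def E.\<mu>_add E.\<mu>_section[OF \<sigma>] E.displacement_unique)
  have \<psi>: "\<psi> (\<sigma>' a \<oplus>\<^bsub>T'\<^esub> \<iota>' w) = \<sigma> a \<oplus>\<^bsub>T\<^esub> \<iota> w" if "a \<in> carrier A" "w \<in> carrier W" for a w
    using that closed
    by (simp add: \<psi>_def E'.\<mu>_add E'.\<mu>_section[OF \<sigma>'] E'.displacement_unique)
  have cases: "\<exists>a\<in>carrier A. \<exists>w\<in>carrier W. t = \<sigma> a \<oplus>\<^bsub>T\<^esub> \<iota> w" if "t \<in> carrier T" for t
    using E.coordinates[OF \<sigma> that] that E.\<mu>_closed by metis
  have cases': "\<exists>a\<in>carrier A. \<exists>w\<in>carrier W. t = \<sigma>' a \<oplus>\<^bsub>T'\<^esub> \<iota>' w" if "t \<in> carrier T'" for t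
    using E'.coordinates[OF \<sigma>' that] that E'.\<mu>_closed by metis
  have "linear_map F T T' \<phi>"
    unfolding \<phi>_def \<pi>_def
    by (intro linear_map_sum E'.T.module_self
        linear_map_comp[OF E'.section_linear[OF \<sigma>'] E.\<mu>_linear]
        linear_map_comp[OF E'.\<iota>_linear E.linear_coordinates[OF \<sigma>]])
  moreover have "\<phi> (s \<otimes>\<^bsub>T\<^esub> t) = \<phi> s \<otimes>\<^bsub>T'\<^esub> \<phi> t" if st: "s \<in> carrier T" "t \<in> carrier T" for s t
  proof -
    obtain a v where s: "a \<in> carrier A" "v \<in> carrier W" "s = \<sigma> a \<oplus>\<^bsub>T\<^esub> \<iota> v" using cases st by blast
    obtain b w where t: "b \<in> carrier A" "w \<in> carrier W" "t = \<sigma> b \<oplus>\<^bsub>T\<^esub> \<iota> w" using cases st by blast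
    show ?thesis
      using s(1,2) t(1,2) closed
      by (simp add: s(3) t(3) \<phi> E.mult_coordinates[OF f] E'.mult_coordinates[OF f'])
  qed
  ultimately have "\<phi> \<in> kv_hom F T T'" by (simp add: kv_hom_def)
  moreover have "bij_betw \<phi> (carrier T) (carrier T')"
  proof (rule bij_betw_byWitness[of _ \<psi>])
    show "\<forall>t\<in>carrier T. \<psi> (\<phi> t) = t" using cases by (metis \<phi> \<psi>)
    show "\<forall>t\<in>carrier T'. \<phi> (\<psi> t) = t" using cases' by (metis \<phi> \<psi>)
    show "\<phi> ` carrier T \<subseteq> carrier T'" using \<open>linear_map F T T' \<phi>\<close> by (auto dest: linear_map_closed)
    show "\<psi> ` carrier T' \<subseteq> carrier T"
    proof (intro image_subsetI)
      fix t assume "t \<in> carrier T'"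
      then obtain a w where "a \<in> carrier A" "w \<in> carrier W" "t = \<sigma>' a \<oplus>\<^bsub>T'\<^esub> \<iota>' w" using cases' by blast
      then show "\<psi> t \<in> carrier T" using closed by (simp add: \<psi>)
    qed
  qed
  moreover have "\<phi> (\<iota> w) = \<iota>' w" if "w \<in> carrier W" for w
    using \<phi>[of "\<zero>\<^bsub>A\<^esub>" w] that by (simp add: E.section_zero[OF \<sigma>] E'.section_zero[OF \<sigma>'])
  moreover have "\<mu>' (\<phi> t) = \<mu> t" if t: "t \<in> carrier T" for t
  proof -
    obtain a w where "a \<in> carrier A" "w \<in> carrier W" "t = \<sigma> a \<oplus>\<^bsub>T\<^esub> \<iota> w" using cases t by blast
    then show ?thesis
      using closed by (simp add: \<phi> E.\<mu>_add E'.\<mu>_add E.\<mu>_section[OF \<sigma>] E'.\<mu>_section[OF \<sigma>'])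
  qed
  ultimately show ?thesis by (auto simp: ext_equiv_def)
qed

text \<open>
  An equivalence carries a section to a section with the same factor set.
\<close>

lemma (in kv_module) factor_set_of_equivalent:
  assumes "kv_extension F A W T \<iota> \<mu>" "kv_extension F A W T' \<iota>' \<mu>'"
    and equiv: "ext_equiv F W (T, \<iota>, \<mu>) (T', \<iota>', \<mu>')"
    and f: "kv_extension.section_factor_set F A W T \<iota> \<mu> \<sigma> f"
  shows "\<exists>\<tau>. kv_extension.section_factor_set F A W T' \<iota>' \<mu>' \<tau> f"
proof -
  interpret E: kv_extension F A W T \<iota> \<mu> by fact
  interpret E': kv_extension F A W T' \<iota>' \<mu>' by fact
  from equiv obtain \<phi> where hom: "\<phi> \<in> kv_hom F T T'"
    and \<phi>_\<iota>: "\<And>w. w \<in> carrier W \<Longrightarrow> \<phi> (\<iota> w) = \<iota>' w"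
    and \<mu>_\<phi>: "\<And>t. t \<in> carrier T \<Longrightarrow> \<mu>' (\<phi> t) = \<mu> t"
    by (auto simp: ext_equiv_def)
  have lin: "linear_map F T T' \<phi>"
    and mult: "\<And>s t. \<lbrakk>s \<in> carrier T; t \<in> carrier T\<rbrakk> \<Longrightarrow> \<phi> (s \<otimes>\<^bsub>T\<^esub> t) = \<phi> s \<otimes>\<^bsub>T'\<^esub> \<phi> t"
    using hom by (auto simp: kv_hom_def)
  note \<sigma> = E.section_factor_setD(1)[OF f] and C = E.section_factor_setD(2)[OF f]
  note closed = E.section_closed[OF \<sigma>] cochain_2_closed[OF C]
  have "E'.linear_section (\<lambda>a. \<phi> (\<sigma> a))"
    using linear_map_comp[OF lin E.section_linear[OF \<sigma>]]
    by (simp add: E'.linear_section_def \<mu>_\<phi> closed E.\<mu>_section[OF \<sigma>])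
  moreover have "\<phi> (\<sigma> a) \<otimes>\<^bsub>T'\<^esub> \<phi> (\<sigma> b) = \<phi> (\<sigma> (a \<otimes>\<^bsub>A\<^esub> b)) \<oplus>\<^bsub>T'\<^esub> \<iota>' (f [a, b])"
    if "a \<in> carrier A" "b \<in> carrier A" for a b
    using that closed
    by (simp add: mult[symmetric] E.section_factor_setD(3)[OF f] linear_map_add[OF lin] \<phi>_\<iota>)
  ultimately have "E'.section_factor_set (\<lambda>a. \<phi> (\<sigma> a)) f"
    using C by (simp add: E'.section_factor_set_def)
  then show ?thesis by blast
qed

section \<open>The extension defined by a cocycle\<close>

locale kv_cocycle = kv_module F A W
  for F :: "('f, 'm) ring_scheme" and A :: "('f, 'a, 'n) module_scheme"
    and W :: "('f, 'a, 'w, 'k) kvmod_scheme" +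
  fixes emb :: "'a \<times> 'w \<Rightarrow> 't" and f :: "'a list \<Rightarrow> 'w"
  assumes emb_inj: "inj_on emb (carrier A \<times> carrier W)"
    and cochain: "f \<in> multilinear_maps F A W 2"
    and cocycle: "coboundary F A W 2 f = \<one>\<^bsub>cochain_group F A W 3\<^esub>"
begin

definition coords :: "'t \<Rightarrow> 'a \<times> 'w"
  where "coords = inv_into (carrier A \<times> carrier W) emb"

text \<open>
  The product formula in coordinates, read as a definition on $A \times W$. The underlying set is
  moved into the type \<open>'t\<close> by \<open>emb\<close>, since middle terms of extensions have to live on that type.
\<close>

definition crossed_product :: "('f, 't) module"
  where "crossed_product =
    \<lparr>carrier = emb ` (carrier A \<times> carrier W),
     mult = (\<lambda>x y. let (a, v) = coords x; (b, w) = coords y in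
       emb (a \<otimes>\<^bsub>A\<^esub> b, f [a, b] \<oplus>\<^bsub>W\<^esub> (lact W a w \<oplus>\<^bsub>W\<^esub> ract W v b))),
     one = undefined,
     zero = emb (\<zero>\<^bsub>A\<^esub>, \<zero>\<^bsub>W\<^esub>),
     add = (\<lambda>x y. let (a, v) = coords x; (b, w) = coords y in emb (a \<oplus>\<^bsub>A\<^esub> b, v \<oplus>\<^bsub>W\<^esub> w)),
     smult = (\<lambda>c x. let (a, v) = coords x in emb (c \<odot>\<^bsub>A\<^esub> a, c \<odot>\<^bsub>W\<^esub> v))\<rparr>"

abbreviation "T \<equiv> crossed_product"

lemma coords_emb [simp]: "\<lbrakk>a \<in> carrier A; v \<in> carrier W\<rbrakk> \<Longrightarrow> coords (emb (a, v)) = (a, v)"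
  using emb_inj by (simp add: coords_def)

lemma carrier_T: "carrier T = emb ` (carrier A \<times> carrier W)"
  by (simp add: crossed_product_def)

lemma emb_closed [simp]: "\<lbrakk>a \<in> carrier A; v \<in> carrier W\<rbrakk> \<Longrightarrow> emb (a, v) \<in> carrier T"
  by (simp add: carrier_T)

lemma T_cases:
  assumes "t \<in> carrier T"
  obtains a v where "a \<in> carrier A" "v \<in> carrier W" "t = emb (a, v)"
  using assms by (auto simp: carrier_T)

lemma T_simps [simp]:
  assumes "a \<in> carrier A" "v \<in> carrier W"
  shows "\<lbrakk>b \<in> carrier A; w \<in> carrier W\<rbrakk> \<Longrightarrow> emb (a, v) \<oplus>\<^bsub>T\<^esub> emb (b, w) = emb (a \<oplus>\<^bsub>A\<^esub> b, v \<oplus>\<^bsub>W\<^esub> w)"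
    and "\<lbrakk>b \<in> carrier A; w \<in> carrier W\<rbrakk> \<Longrightarrow> emb (a, v) \<otimes>\<^bsub>T\<^esub> emb (b, w) =
      emb (a \<otimes>\<^bsub>A\<^esub> b, f [a, b] \<oplus>\<^bsub>W\<^esub> (lact W a w \<oplus>\<^bsub>W\<^esub> ract W v b))"
    and "c \<odot>\<^bsub>T\<^esub> emb (a, v) = emb (c \<odot>\<^bsub>A\<^esub> a, c \<odot>\<^bsub>W\<^esub> v)"
  using assms by (simp_all add: crossed_product_def)

lemma T_zero: "\<zero>\<^bsub>T\<^esub> = emb (\<zero>\<^bsub>A\<^esub>, \<zero>\<^bsub>W\<^esub>)"
  by (simp add: crossed_product_def)

lemma f_closed [simp]: "\<lbrakk>a \<in> carrier A; b \<in> carrier A\<rbrakk> \<Longrightarrow> f [a, b] \<in> carrier W"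
  by (rule cochain_2_closed[OF cochain])

lemma f_bilinear: "bilinear_map F A A W (\<lambda>a b. f [a, b])"
  using cochain by (simp add: multilinear_maps_2)

lemmas f_linear =
  linear_map_add[OF linear_map_bilinear_left[OF f_bilinear]]
  linear_map_add[OF linear_map_bilinear_right[OF f_bilinear]]
  linear_map_smult[OF linear_map_bilinear_left[OF f_bilinear]]
  linear_map_smult[OF linear_map_bilinear_right[OF f_bilinear]]

lemma module_T: "module F T"
proof (rule moduleI)
  show "cring F" by (rule module.axioms(1)[OF alg.module_self])
  show "abelian_group T"
  proof (rule abelian_groupI)
    fix x assume "x \<in> carrier T"
    then obtain a v where x: "a \<in> carrier A" "v \<in> carrier W" "x = emb (a, v)" by (rule T_cases)
    show "\<zero>\<^bsub>T\<^esub> \<oplus>\<^bsub>T\<^esub> x = x" using x(1,2) by (simp add: x(3) T_zero)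
    show "\<exists>y\<in>carrier T. y \<oplus>\<^bsub>T\<^esub> x = \<zero>\<^bsub>T\<^esub>"
      by (rule bexI[of _ "emb (\<ominus>\<^bsub>A\<^esub> a, \<ominus>\<^bsub>W\<^esub> v)"])
        (use x(1,2) in \<open>simp_all add: x(3) T_zero alg.V.M.l_neg W.M.l_neg\<close>)
    fix y assume "y \<in> carrier T"
    then obtain b w where y: "b \<in> carrier A" "w \<in> carrier W" "y = emb (b, w)" by (rule T_cases)
    show "x \<oplus>\<^bsub>T\<^esub> y \<in> carrier T" using x(1,2) y(1,2) by (simp add: x(3) y(3))
    show "x \<oplus>\<^bsub>T\<^esub> y = y \<oplus>\<^bsub>T\<^esub> x"
      using x(1,2) y(1,2) by (simp add: x(3) y(3) alg.V.M.a_comm W.M.a_comm)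
    fix z assume "z \<in> carrier T"
    then obtain c u where z: "c \<in> carrier A" "u \<in> carrier W" "z = emb (c, u)" by (rule T_cases)
    show "(x \<oplus>\<^bsub>T\<^esub> y) \<oplus>\<^bsub>T\<^esub> z = x \<oplus>\<^bsub>T\<^esub> (y \<oplus>\<^bsub>T\<^esub> z)"
      using x(1,2) y(1,2) z(1,2) by (simp add: x(3) y(3) z(3) alg.V.M.a_assoc W.M.a_assoc)
  qed (simp add: T_zero)
qed (auto elim!: T_cases simp: alg.V.smult_l_distr W.smult_l_distr alg.V.smult_r_distr
    W.smult_r_distr alg.V.smult_assoc1 W.smult_assoc1)

lemma bilinear_T: "bilinear_map F T T T (mult T)"
  unfolding bilinear_map_def
  by (intro conjI ballI linear_mapI)
    (auto elim!: T_cases simp: f_linear alg.product_add_left alg.product_add_right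
      alg.product_smult_left alg.product_smult_right lact_add_left lact_add_right
      lact_smult_left lact_smult_right ract_add_left ract_add_right ract_smult_left
      ract_smult_right W.smult_r_distr W.M.a_ac)

text \<open>
  The $W$-component of the KV-identity splits into four independent identities: the cocycle identity
  for the terms with \<open>f\<close>, the left module identity for those with \<open>w\<close>, and the mixed module identity
  once for those with \<open>u\<close> and once for those with \<open>v\<close>.
\<close>

lemma kv_algebra_T: "kv_algebra F T"
proof (rule kv_algebraI)
  fix x y z assume "x \<in> carrier T" "y \<in> carrier T" "z \<in> carrier T"
  then obtain a u b v c w where
    x: "a \<in> carrier A" "u \<in> carrier W" "x = emb (a, u)" and
    y: "b \<in> carrier A" "v \<in> carrier W" "y = emb (b, v)" and
    z: "c \<in> carrier A" "w \<in> carrier W" "z = emb (c, w)"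
    by (elim T_cases)
  note mem = x(1,2) y(1,2) z(1,2)
  let ?f = "\<lambda>a b. lact W b (f [a, c]) \<oplus>\<^bsub>W\<^esub> ract W (f [a, b]) c \<oplus>\<^bsub>W\<^esub>
    (f [a \<otimes>\<^bsub>A\<^esub> b, c] \<oplus>\<^bsub>W\<^esub> f [b, a \<otimes>\<^bsub>A\<^esub> c])"
  let ?l = "\<lambda>a b. lact W (a \<otimes>\<^bsub>A\<^esub> b) w \<oplus>\<^bsub>W\<^esub> lact W b (lact W a w)"
  let ?m = "\<lambda>a v. ract W (lact W a v) c \<oplus>\<^bsub>W\<^esub> ract W v (a \<otimes>\<^bsub>A\<^esub> c)"
  let ?n = "\<lambda>b u. ract W (ract W u b) c \<oplus>\<^bsub>W\<^esub> lact W b (ract W u c)"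
  have expand: "(emb (a, u) \<otimes>\<^bsub>T\<^esub> emb (b, v)) \<otimes>\<^bsub>T\<^esub> z \<oplus>\<^bsub>T\<^esub> emb (b, v) \<otimes>\<^bsub>T\<^esub> (emb (a, u) \<otimes>\<^bsub>T\<^esub> z) =
      emb ((a \<otimes>\<^bsub>A\<^esub> b) \<otimes>\<^bsub>A\<^esub> c \<oplus>\<^bsub>A\<^esub> b \<otimes>\<^bsub>A\<^esub> (a \<otimes>\<^bsub>A\<^esub> c), ?f a b \<oplus>\<^bsub>W\<^esub> (?l a b \<oplus>\<^bsub>W\<^esub> (?m a v \<oplus>\<^bsub>W\<^esub> ?n b u)))"
    if "a \<in> carrier A" "b \<in> carrier A" "u \<in> carrier W" "v \<in> carrier W" for a b u v
    using that z(1,2) by (simp add: z(3) lact_add_right ract_add_left W.M.a_ac)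
  have "?f a b = ?f b a"
    using cocycle mem unfolding coboundary_2_eq_one_iff[OF cochain] by blast
  moreover have "?l a b = ?l b a"
    using mem by (intro left_module_identity)
  \<comment> \<open>\<open>?m\<close> and \<open>?n\<close> are the two sides of the mixed identity; exchanging \<open>(a, u)\<close> and \<open>(b, v)\<close>
    turns \<open>?m a v \<oplus> ?n b u\<close> into \<open>?m b u \<oplus> ?n a v\<close>\<close>
  moreover have "?m a v = ?n a v" "?m b u = ?n b u"
    using mem by (auto intro: mixed_module_identity)
  moreover have "?n a v \<oplus>\<^bsub>W\<^esub> ?n b u = ?n b u \<oplus>\<^bsub>W\<^esub> ?n a v"
    using mem by (intro W.M.a_comm) simp_all
  ultimately show "(x \<otimes>\<^bsub>T\<^esub> y) \<otimes>\<^bsub>T\<^esub> z \<oplus>\<^bsub>T\<^esub> y \<otimes>\<^bsub>T\<^esub> (x \<otimes>\<^bsub>T\<^esub> z) =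
      (y \<otimes>\<^bsub>T\<^esub> x) \<otimes>\<^bsub>T\<^esub> z \<oplus>\<^bsub>T\<^esub> x \<otimes>\<^bsub>T\<^esub> (y \<otimes>\<^bsub>T\<^esub> z)"
    unfolding x(3) y(3) expand[OF mem(1,3,2,4)] expand[OF mem(3,1,4,2)] alg.kv_identity[OF mem(1,3,5)]
    by (simp only:)
qed (rule alg.K.field_axioms module_T bilinear_T)+

definition \<iota> :: "'w \<Rightarrow> 't" where "\<iota> w = emb (\<zero>\<^bsub>A\<^esub>, w)"

definition \<mu> :: "'t \<Rightarrow> 'a" where "\<mu> t = fst (coords t)"

lemma zero_action:
  "w \<in> carrier W \<Longrightarrow> lact W \<zero>\<^bsub>A\<^esub> w = \<zero>\<^bsub>W\<^esub>" "a \<in> carrier A \<Longrightarrow> lact W a \<zero>\<^bsub>W\<^esub> = \<zero>\<^bsub>W\<^esub>"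
  "w \<in> carrier W \<Longrightarrow> ract W w \<zero>\<^bsub>A\<^esub> = \<zero>\<^bsub>W\<^esub>" "a \<in> carrier A \<Longrightarrow> ract W \<zero>\<^bsub>W\<^esub> a = \<zero>\<^bsub>W\<^esub>"
  "a \<in> carrier A \<Longrightarrow> f [a, \<zero>\<^bsub>A\<^esub>] = \<zero>\<^bsub>W\<^esub>" "a \<in> carrier A \<Longrightarrow> f [\<zero>\<^bsub>A\<^esub>, a] = \<zero>\<^bsub>W\<^esub>"
  "a \<in> carrier A \<Longrightarrow> a \<otimes>\<^bsub>A\<^esub> \<zero>\<^bsub>A\<^esub> = \<zero>\<^bsub>A\<^esub>" "a \<in> carrier A \<Longrightarrow> \<zero>\<^bsub>A\<^esub> \<otimes>\<^bsub>A\<^esub> a = \<zero>\<^bsub>A\<^esub>"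
  using linear_map_zero[OF alg.module_self module_W linear_map_bilinear_left[OF lact_bilinear]]
    linear_map_zero[OF module_W module_W linear_map_bilinear_right[OF lact_bilinear]]
    linear_map_zero[OF alg.module_self module_W linear_map_bilinear_right[OF ract_bilinear]]
    linear_map_zero[OF module_W module_W linear_map_bilinear_left[OF ract_bilinear]]
    linear_map_zero[OF alg.module_self module_W linear_map_bilinear_right[OF f_bilinear]]
    linear_map_zero[OF alg.module_self module_W linear_map_bilinear_left[OF f_bilinear]]
    linear_map_zero[OF alg.module_self alg.module_self linear_map_bilinear_right[OF alg.mult_bilinear]]
    linear_map_zero[OF alg.module_self alg.module_self linear_map_bilinear_left[OF alg.mult_bilinear]]
  by auto

lemma kv_extension_T: "kv_extension F A W T \<iota> \<mu>"
proof -
  interpret T: kv_algebra F T by (rule kv_algebra_T)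
  show ?thesis
  proof
    show "\<iota> \<in> kv_hom F (trivial_kv W) T"
      by (auto simp: kv_hom_def trivial_kv_def linear_map_def \<iota>_def zero_action)
    show "\<mu> \<in> kv_hom F T A"
      by (auto simp: kv_hom_def linear_map_def \<mu>_def elim!: T_cases)
    show "inj_on \<iota> (carrier W)"
    proof (rule inj_onI)
      fix v w assume "v \<in> carrier W" "w \<in> carrier W" "\<iota> v = \<iota> w"
      then have "(\<zero>\<^bsub>A\<^esub>, v) = (\<zero>\<^bsub>A\<^esub>, w)"
        by (intro inj_onD[OF emb_inj]) (simp_all add: \<iota>_def)
      then show "v = w" by simp
    qed
    show "\<iota> ` carrier W = a_kernel T A \<mu>"
      by (auto simp: a_kernel_def' \<iota>_def \<mu>_def elim!: T_cases)
    show "\<mu> ` carrier T = carrier A"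
    proof (intro equalityI subsetI)
      fix a assume "a \<in> carrier A"
      then have "\<mu> (emb (a, \<zero>\<^bsub>W\<^esub>)) = a" "emb (a, \<zero>\<^bsub>W\<^esub>) \<in> carrier T" by (simp_all add: \<mu>_def)
      then show "a \<in> \<mu> ` carrier T" by (metis imageI)
    qed (auto simp: \<mu>_def elim!: T_cases)
    show "t \<otimes>\<^bsub>T\<^esub> \<iota> w = \<iota> (lact W (\<mu> t) w) \<and> \<iota> w \<otimes>\<^bsub>T\<^esub> t = \<iota> (ract W w (\<mu> t))"
      if "t \<in> carrier T" "w \<in> carrier W" for t w
      using that by (auto simp: \<iota>_def \<mu>_def zero_action elim!: T_cases)
  qed
qed

lemma factor_set_T:
  "kv_extension.section_factor_set F A W T \<iota> \<mu> (\<lambda>a. emb (a, \<zero>\<^bsub>W\<^esub>)) f"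
proof -
  interpret E: kv_extension F A W T \<iota> \<mu> by (rule kv_extension_T)
  have "linear_map F A T (\<lambda>a. emb (a, \<zero>\<^bsub>W\<^esub>))"
    by (rule linear_mapI) simp_all
  then show ?thesis
    by (auto simp: E.section_factor_set_def E.linear_section_def cochain \<mu>_def \<iota>_def zero_action)
qed

end

section \<open>The classification\<close>

text \<open>
  A relation \<open>R\<close> that is total on both sides and matches the relation \<open>E\<close> on \<open>X\<close> with equality of \<open>K\<close>
  on \<open>Z\<close> induces a bijection between the classes. No map from \<open>X\<close> to \<open>Z\<close> has to be chosen, which
  suits factor sets: an extension has many of them.
\<close>

lemma bij_betw_classes:
  assumes ex_z: "\<And>x. x \<in> X \<Longrightarrow> \<exists>z\<in>Z. R x z" and ex_x: "\<And>z. z \<in> Z \<Longrightarrow> \<exists>x\<in>X. R x z"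
    and match: "\<And>x y z w. \<lbrakk>x \<in> X; y \<in> X; z \<in> Z; w \<in> Z; R x z; R y w\<rbrakk> \<Longrightarrow> (x, y) \<in> E \<longleftrightarrow> K z = K w"
    and E: "E \<subseteq> X \<times> X"
  shows "bij_betw (\<lambda>c. {x \<in> X. \<exists>z\<in>Z. K z = c \<and> R x z}) (K ` Z) (X // E)"
proof -
  let ?\<Phi> = "\<lambda>c. {x \<in> X. \<exists>z\<in>Z. K z = c \<and> R x z}"
  have fibre: "?\<Phi> (K z) = E `` {x}" if "x \<in> X" "z \<in> Z" "R x z" for x z
  proof (intro equalityI subsetI)
    fix y assume "y \<in> ?\<Phi> (K z)"
    then show "y \<in> E `` {x}" using match that by force
  next
    fix y assume "y \<in> E `` {x}"
    then have xy: "(x, y) \<in> E" "y \<in> X" using E by auto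
    then obtain w where "w \<in> Z" "R y w" using ex_z by blast
    then show "y \<in> ?\<Phi> (K z)" using match[of x y z w] that xy by auto
  qed
  have "inj_on ?\<Phi> (K ` Z)"
  proof (rule inj_onI, elim imageE)
    fix c d z w assume z: "z \<in> Z" "c = K z" and w: "w \<in> Z" "d = K w" and eq: "?\<Phi> c = ?\<Phi> d"
    obtain x where x: "x \<in> X" "R x z" using ex_x z by blast
    then have "x \<in> ?\<Phi> d" using eq z by blast
    then obtain w' where "w' \<in> Z" "K w' = K w" "R x w'" using w by blast
    then show "c = d" using match[of x x z w'] match[of x x z z] x z w by simp
  qed
  moreover have "?\<Phi> ` K ` Z = X // E"
  proof (intro equalityI subsetI)
    fix C assume "C \<in> ?\<Phi> ` K ` Z"
    then obtain z where z: "z \<in> Z" "C = ?\<Phi> (K z)" by blast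
    obtain x where x: "x \<in> X" "R x z" using ex_x z by blast
    show "C \<in> X // E" unfolding z(2) fibre[OF x(1) z(1) x(2)] using x by (intro quotientI)
  next
    fix C assume "C \<in> X // E"
    then obtain x where x: "x \<in> X" "C = E `` {x}" by (rule quotientE)
    obtain z where z: "z \<in> Z" "R x z" using ex_z x by blast
    show "C \<in> ?\<Phi> ` K ` Z" unfolding x(2) fibre[OF x(1) z, symmetric] using z by blast
  qed
  ultimately show ?thesis by (simp add: bij_betw_def)
qed

context kv_module
begin

definition cohomology_class :: "('a list \<Rightarrow> 'w) \<Rightarrow> ('a list \<Rightarrow> 'w) set"
  where "cohomology_class f =
    coboundary F A W 1 ` carrier (cochain_group F A W 1) #>\<^bsub>cochain_group F A W 2\<^esub> f"

lemma carrier_kv_H2: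
  "carrier (kv_H2 F A W) = cohomology_class `
    {f \<in> multilinear_maps F A W 2. coboundary F A W 2 f = \<one>\<^bsub>cochain_group F A W 3\<^esub>}"
  by (simp add: kv_H2_def carrier_FactGroup cohomology_class_def kernel_def cochain_group_def r_coset_def)

lemma cohomology_class_eq_iff:
  assumes f: "f \<in> multilinear_maps F A W 2" and g: "g \<in> multilinear_maps F A W 2"
  shows "cohomology_class f = cohomology_class g \<longleftrightarrow>
    (\<exists>k\<in>multilinear_maps F A W 1. f = coboundary F A W 1 k \<otimes>\<^bsub>cochain_group F A W 2\<^esub> g)"
proof -
  interpret C2: comm_group "cochain_group F A W 2" by (rule comm_group_cochains)
  let ?B = "coboundary F A W 1 ` carrier (cochain_group F A W 1)"
  have C: "f \<in> carrier (cochain_group F A W 2)" "g \<in> carrier (cochain_group F A W 2)"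
    using f g by (simp_all add: cochain_group_def)
  have "cohomology_class f = cohomology_class g \<longleftrightarrow> f \<in> ?B #>\<^bsub>cochain_group F A W 2\<^esub> g"
    using C2.repr_independence[OF _ C(2) subgroup_coboundaries, of f]
      C2.rcos_self[OF C(1) subgroup_coboundaries]
    by (auto simp: cohomology_class_def)
  also have "\<dots> \<longleftrightarrow>
      (\<exists>k\<in>multilinear_maps F A W 1. f = coboundary F A W 1 k \<otimes>\<^bsub>cochain_group F A W 2\<^esub> g)"
    by (auto simp: r_coset_def cochain_group_def)
  finally show ?thesis .
qed

definition factor_set :: "('f, 'a, 'w, 't) ext_data \<Rightarrow> ('a list \<Rightarrow> 'w) \<Rightarrow> bool"
  where "factor_set = (\<lambda>(T, \<iota>, \<mu>) f. \<exists>\<sigma>. kv_extension.section_factor_set F A W T \<iota> \<mu> \<sigma> f)"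

text \<open>
  In one direction, transport a section along the equivalence and compare the two sections of
  the second extension. In the other, change the section of the first extension so that both
  extensions acquire the factor set \<open>g\<close>.
\<close>

lemma ext_equiv_iff_cohomologous:
  assumes E: "kv_extension F A W T \<iota> \<mu>" and E': "kv_extension F A W T' \<iota>' \<mu>'"
    and f: "factor_set (T, \<iota>, \<mu>) f" and g: "factor_set (T', \<iota>', \<mu>') g"
  shows "ext_equiv F W (T, \<iota>, \<mu>) (T', \<iota>', \<mu>') \<longleftrightarrow> cohomology_class f = cohomology_class g"
proof -
  interpret E: kv_extension F A W T \<iota> \<mu> by fact
  interpret E': kv_extension F A W T' \<iota>' \<mu>' by fact
  obtain \<sigma> \<tau> where \<sigma>: "E.section_factor_set \<sigma> f" and \<tau>: "E'.section_factor_set \<tau> g"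
    using f g by (auto simp: factor_set_def)
  note C = E.section_factor_setD(2)[OF \<sigma>] E'.section_factor_setD(2)[OF \<tau>]
  show ?thesis
    unfolding cohomology_class_eq_iff[OF C]
  proof
    assume "ext_equiv F W (T, \<iota>, \<mu>) (T', \<iota>', \<mu>')"
    then obtain \<sigma>' where "E'.section_factor_set \<sigma>' f"
      using factor_set_of_equivalent[OF E E' _ \<sigma>] by blast
    then show "\<exists>k\<in>multilinear_maps F A W 1. f = coboundary F A W 1 k \<otimes>\<^bsub>cochain_group F A W 2\<^esub> g"
      using \<tau> by (rule E'.factor_sets_cohomologous)
  next
    assume "\<exists>k\<in>multilinear_maps F A W 1. f = coboundary F A W 1 k \<otimes>\<^bsub>cochain_group F A W 2\<^esub> g"
    then obtain \<sigma>' where "E.section_factor_set \<sigma>' g"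
      using E.change_of_section[OF \<sigma> _ C(2)] by blast
    then show "ext_equiv F W (T, \<iota>, \<mu>) (T', \<iota>', \<mu>')"
      using \<tau> by (rule ext_equiv_of_common_factor_set[OF E E'])
  qed
qed

lemma splittable_extension_has_factor_set:
  assumes "E \<in> splittable_extensions F A W"
  shows "\<exists>f\<in>{f \<in> multilinear_maps F A W 2. coboundary F A W 2 f = \<one>\<^bsub>cochain_group F A W 3\<^esub>}. factor_set E f"
proof -
  obtain T \<iota> \<mu> where E: "E = (T, \<iota>, \<mu>)" by (cases E)
  interpret E: kv_extension F A W T \<iota> \<mu>
    using assms unfolding E by (simp add: splittable_extensions_def extension_iff_kv_extension)
  have "splittable F W (T, \<iota>, \<mu>)"
    using assms unfolding E by (simp add: splittable_extensions_def)
  then obtain \<sigma> f where f: "E.section_factor_set \<sigma> f"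
    using E.linear_section_of_splittable E.section_factor_set_exists by blast
  then show ?thesis
    using E.section_factor_setD(2)[OF f] E.factor_set_cocycle[OF f] unfolding E factor_set_def by blast
qed

lemma cocycle_is_factor_set:
  fixes emb :: "'a \<times> 'w \<Rightarrow> 't"
  assumes "inj_on emb (carrier A \<times> carrier W)"
    and "f \<in> multilinear_maps F A W 2" "coboundary F A W 2 f = \<one>\<^bsub>cochain_group F A W 3\<^esub>"
  shows "\<exists>E\<in>(splittable_extensions F A W :: ('f, 'a, 'w, 't) ext_data set). factor_set E f"
proof -
  interpret c: kv_cocycle F A W emb f
    using assms by unfold_locales
  interpret E: kv_extension F A W c.T c.\<iota> c.\<mu> by (rule c.kv_extension_T)
  note f = c.factor_set_T
  have "(c.T, c.\<iota>, c.\<mu>) \<in> splittable_extensions F A W"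
    using E.splittable_of_linear_section[OF E.section_factor_setD(1)[OF f]] c.kv_extension_T
    by (simp add: splittable_extensions_def extension_iff_kv_extension)
  moreover have "factor_set (c.T, c.\<iota>, c.\<mu>) f"
    using f unfolding factor_set_def prod.case by blast
  ultimately show ?thesis by blast
qed

lemma bij_betw_H2_splittable_extensions:
  fixes emb :: "'a \<times> 'w \<Rightarrow> 't"
  assumes inj: "inj_on emb (carrier A \<times> carrier W)"
  shows "\<exists>\<Phi>. bij_betw \<Phi> (carrier (kv_H2 F A W))
    ((splittable_extensions F A W :: ('f, 'a, 'w, 't) ext_data set) // ext_equiv_rel F A W)"
  unfolding carrier_kv_H2
proof (rule exI, rule bij_betw_classes[where R = factor_set])
  fix E E' :: "('f, 'a, 'w, 't) ext_data" and f g
  assume E: "E \<in> splittable_extensions F A W" "E' \<in> splittable_extensions F A W"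
    and fg: "factor_set E f" "factor_set E' g"
  obtain T \<iota> \<mu> T' \<iota>' \<mu>' where eq: "E = (T, \<iota>, \<mu>)" "E' = (T', \<iota>', \<mu>')"
    by (metis prod.exhaust)
  have "kv_extension F A W T \<iota> \<mu>" "kv_extension F A W T' \<iota>' \<mu>'"
    using E unfolding eq by (simp_all add: splittable_extensions_def extension_iff_kv_extension)
  then show "(E, E') \<in> ext_equiv_rel F A W \<longleftrightarrow> cohomology_class f = cohomology_class g"
    using ext_equiv_iff_cohomologous fg E unfolding eq by (simp add: ext_equiv_rel_def)
next
  fix E :: "('f, 'a, 'w, 't) ext_data"
  assume "E \<in> splittable_extensions F A W"
  then show "\<exists>f\<in>{f \<in> multilinear_maps F A W 2. coboundary F A W 2 f = \<one>\<^bsub>cochain_group F A W 3\<^esub>}. factor_set E f"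
    by (rule splittable_extension_has_factor_set)
next
  fix f assume "f \<in> {f \<in> multilinear_maps F A W 2. coboundary F A W 2 f = \<one>\<^bsub>cochain_group F A W 3\<^esub>}"
  then show "\<exists>E\<in>(splittable_extensions F A W :: ('f, 'a, 'w, 't) ext_data set). factor_set E f"
    using cocycle_is_factor_set[OF inj] by blast
next
  show "ext_equiv_rel F A W \<subseteq> splittable_extensions F A W \<times> (splittable_extensions F A W :: ('f, 'a, 'w, 't) ext_data set)"
    by (auto simp: ext_equiv_rel_def)
qed

end

theorem theorem5p1:
  fixes F :: "('f, 'm) ring_scheme"
    and A :: "('f, 'a, 'n) module_scheme"
    and W :: "('f, 'a, 'w, 'k) kvmod_scheme"
    and emb :: "'a \<times> 'w \<Rightarrow> 't"
  assumes "field F"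
    and char_zero: "\<And>n::nat. n > 0 \<Longrightarrow> [n] \<cdot>\<^bsub>F\<^esub> \<one>\<^bsub>F\<^esub> \<noteq> \<zero>\<^bsub>F\<^esub>"
    and "kv_algebra F A"
    and "kv_module F A W"
    and universe: "inj_on emb (carrier A \<times> carrier W)"
  shows "\<exists>\<Phi> :: ('a list \<Rightarrow> 'w) set \<Rightarrow> ('f, 'a, 'w, 't) ext_data set.
    bij_betw \<Phi> (carrier (kv_H2 F A W))
      ((splittable_extensions F A W :: ('f, 'a, 'w, 't) ext_data set) // ext_equiv_rel F A W)"
  using kv_module.bij_betw_H2_splittable_extensions[OF \<open>kv_module F A W\<close> universe] .

end
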